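(* If $\mathbb{C}$ is an exact category satisfying Condition P, then $\mathbb{C}$ is coprotomodular.
   Context: A category is regular if it is finitely complete, admits coequalizers of kernel pairs, and its regular epimorphisms are pullback stable. A regular category is exact (in the sense of Barr) if every internal equivalence relation in it is effective, i.e. is the kernel pair of some morphism. For an object $B$ of a category $\mathbb{D}$, the category $\mathbf{Pt}_{\mathbb{D}}(B)$ has as objects triples $(A,\alpha,\beta)$ with $\alpha:A\to B$, $\beta:B\to A$ and $\alpha\beta=1_B$; a morphism $(A,\alpha,\beta)\to(A',\alpha',\beta')$ is a morphism $f:A\to A'$ with $\alpha' f=\alpha$ and $f\beta=\beta'$. If pullbacks of split epimorphisms along arbitrary morphisms exist in $\mathbb{D}$, each $p:E\to B$ determines a pullback functor $p^*:\mathbf{Pt}_{\mathbb{D}}(B)\to\mathbf{Pt}_{\mathbb{D}}(E)$ sending $(A,\alpha,\beta)$ to $(E\times_B A,\pi_1,\langle 1_E,\beta p\rangle)$, where $(E\times_B A,\pi_1,\pi_2)$ is the pullback of $p$ and $\alpha$. The category $\mathbb{D}$ is protomodular if pullbacks of split epimorphisms along arbitrary morphisms exist in $\mathbb{D}$ and each functor $p^*$ reflects isomorphisms. A category is coprotomodular if its opposite category is protomodular. A feeble pullback in a category with finite limits is a commutative square such that the unique induced morphism from its initial corner into the pullback is a regular epimorphism. A category $\mathbb{C}$ with finite limits is said to satisfy Condition P if: (a) finite coproducts exist in $\mathbb{C}$; (b) binary coproducts of pullback squares are pullback squares in $\mathbb{C}$ (that is, given two pullback squares, the square obtained by taking the binary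 coproduct of corresponding objects and morphisms is a pullback); (c) for each monomorphism $m:S\to A$ in $\mathbb{C}$, the commutative square with top $m+1_S:S+S\to A+S$, left side $[1_S,1_S]:S+S\to S$, right side $[1_A,m]:A+S\to A$ and bottom $m:S\to A$ is a pullback; (d) for each regular epimorphism $p:E\to B$ in $\mathbb{C}$, the commutative square with top $p+p:E+E\to B+B$, left side $[1_E,1_E]:E+E\to E$, right side $[1_B,1_B]:B+B\to B$ and bottom $p:E\to B$ is a feeble pullback. *)

theory Defs
  imports Main
begin

section \<open>Categories, functors and limits\<close>

text \<open>Composition is written in applicative order: \<open>g \<cdot> f\<close> is \<open>f\<close> followed by \<open>g\<close>.
  Values of the operations outside \<open>Obj\<close> and \<open>Arr\<close> (or on non-composable pairs) are irrelevant.\<close>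

record ('o, 'm) cat =
  Obj :: "'o set"
  Arr :: "'m set"
  Dom :: "'m \<Rightarrow> 'o"
  Cod :: "'m \<Rightarrow> 'o"
  Ident :: "'o \<Rightarrow> 'm"
  Comp :: "'m \<Rightarrow> 'm \<Rightarrow> 'm" (infixl "\<cdot>\<index>" 70)

definition hom :: "('o, 'm) cat \<Rightarrow> 'o \<Rightarrow> 'o \<Rightarrow> 'm set" where
  "hom C A B = {f \<in> Arr C. Dom C f = A \<and> Cod C f = B}"

locale category =
  fixes C :: "('o, 'm) cat" (structure)
  assumes Dom_Obj: "f \<in> Arr C \<Longrightarrow> Dom C f \<in> Obj C"
    and Cod_Obj: "f \<in> Arr C \<Longrightarrow> Cod C f \<in> Obj C"
    and Id_hom: "A \<in> Obj C \<Longrightarrow> Ident C A \<in> hom C A A"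
    and Comp_hom: "f \<in> hom C X Y \<Longrightarrow> g \<in> hom C Y Z \<Longrightarrow> g \<cdot> f \<in> hom C X Z"
    and Comp_Id_right: "f \<in> hom C X Y \<Longrightarrow> f \<cdot> Ident C X = f"
    and Comp_Id_left: "f \<in> hom C X Y \<Longrightarrow> Ident C Y \<cdot> f = f"
    and Comp_assoc: "f \<in> hom C W X \<Longrightarrow> g \<in> hom C X Y \<Longrightarrow> h \<in> hom C Y Z
      \<Longrightarrow> (h \<cdot> g) \<cdot> f = h \<cdot> (g \<cdot> f)"

definition opp :: "('o, 'm) cat \<Rightarrow> ('o, 'm) cat" where
  "opp C = \<lparr>Obj = Obj C, Arr = Arr C, Dom = Cod C, Cod = Dom C, Ident = Ident C,
            Comp = (\<lambda>g f. f \<cdot>\<^bsub>C\<^esub> g)\<rparr>"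

record ('a, 'b, 'o, 'm) func =
  FObj :: "'a \<Rightarrow> 'o"
  FArr :: "'b \<Rightarrow> 'm"

definition is_functor ::
  "('a, 'b) cat \<Rightarrow> ('o, 'm) cat \<Rightarrow> ('a, 'b, 'o, 'm) func \<Rightarrow> bool" where
  "is_functor J C F \<longleftrightarrow> category J \<and> category C \<and>
     (\<forall>X \<in> Obj J. FObj F X \<in> Obj C) \<and>
     (\<forall>X Y. \<forall>f \<in> hom J X Y. FArr F f \<in> hom C (FObj F X) (FObj F Y)) \<and>
     (\<forall>X \<in> Obj J. FArr F (Ident J X) = Ident C (FObj F X)) \<and>
     (\<forall>X Y Z. \<forall>f \<in> hom J X Y. \<forall>g \<in> hom J Y Z.
        FArr F (g \<cdot>\<^bsub>J\<^esub> f) = FArr F g \<cdot>\<^bsub>C\<^esub> FArr F f)"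

definition is_cone ::
  "('a, 'b) cat \<Rightarrow> ('o, 'm) cat \<Rightarrow> ('a, 'b, 'o, 'm) func \<Rightarrow> 'o \<Rightarrow> ('a \<Rightarrow> 'm) \<Rightarrow> bool" where
  "is_cone J C F L \<pi> \<longleftrightarrow> L \<in> Obj C \<and> (\<forall>j \<in> Obj J. \<pi> j \<in> hom C L (FObj F j)) \<and>
     (\<forall>u \<in> Arr J. FArr F u \<cdot>\<^bsub>C\<^esub> \<pi> (Dom J u) = \<pi> (Cod J u))"

definition is_limit ::
  "('a, 'b) cat \<Rightarrow> ('o, 'm) cat \<Rightarrow> ('a, 'b, 'o, 'm) func \<Rightarrow> 'o \<Rightarrow> ('a \<Rightarrow> 'm) \<Rightarrow> bool" where
  "is_limit J C F L \<pi> \<longleftrightarrow> is_cone J C F L \<pi> \<and>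
     (\<forall>L' \<pi>'. is_cone J C F L' \<pi>' \<longrightarrow>
        (\<exists>!h. h \<in> hom C L' L \<and> (\<forall>j \<in> Obj J. \<pi> j \<cdot>\<^bsub>C\<^esub> h = \<pi>' j)))"

text \<open>Every finite category is isomorphic to one whose objects and arrows are natural numbers,
  so index categories of type \<open>(nat, nat) cat\<close> account for all finite limits. Finiteness of
  \<open>Arr J\<close> entails that of \<open>Obj J\<close>.\<close>

definition finitely_complete :: "('o, 'm) cat \<Rightarrow> bool" where
  "finitely_complete C \<longleftrightarrow> category C \<and>
     (\<forall>(J :: (nat, nat) cat) F. finite (Arr J) \<and> is_functor J C F \<longrightarrow> (\<exists>L \<pi>. is_limit J C F L \<pi>))"


section \<open>Special morphisms and squares\<close>

definition monic :: "('o, 'm) cat \<Rightarrow> 'm \<Rightarrow> bool" where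
  "monic C m \<longleftrightarrow> m \<in> Arr C \<and>
     (\<forall>W. \<forall>f \<in> hom C W (Dom C m). \<forall>g \<in> hom C W (Dom C m). m \<cdot>\<^bsub>C\<^esub> f = m \<cdot>\<^bsub>C\<^esub> g \<longrightarrow> f = g)"

definition iso :: "('o, 'm) cat \<Rightarrow> 'm \<Rightarrow> bool" where
  "iso C f \<longleftrightarrow> f \<in> Arr C \<and> (\<exists>g \<in> hom C (Cod C f) (Dom C f).
     g \<cdot>\<^bsub>C\<^esub> f = Ident C (Dom C f) \<and> f \<cdot>\<^bsub>C\<^esub> g = Ident C (Cod C f))"

definition split_epi :: "('o, 'm) cat \<Rightarrow> 'm \<Rightarrow> bool" where
  "split_epi C a \<longleftrightarrow> a \<in> Arr C \<and>
     (\<exists>b \<in> hom C (Cod C a) (Dom C a). a \<cdot>\<^bsub>C\<^esub> b = Ident C (Cod C a))"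

definition is_coequalizer :: "('o, 'm) cat \<Rightarrow> 'm \<Rightarrow> 'm \<Rightarrow> 'm \<Rightarrow> bool" where
  "is_coequalizer C f g q \<longleftrightarrow>
     f \<in> Arr C \<and> g \<in> hom C (Dom C f) (Cod C f) \<and>
     q \<in> Arr C \<and> Dom C q = Cod C f \<and> q \<cdot>\<^bsub>C\<^esub> f = q \<cdot>\<^bsub>C\<^esub> g \<and>
     (\<forall>Z. \<forall>h \<in> hom C (Cod C f) Z. h \<cdot>\<^bsub>C\<^esub> f = h \<cdot>\<^bsub>C\<^esub> g \<longrightarrow>
        (\<exists>!k. k \<in> hom C (Cod C q) Z \<and> k \<cdot>\<^bsub>C\<^esub> q = h))"

definition regular_epi :: "('o, 'm) cat \<Rightarrow> 'm \<Rightarrow> bool" where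
  "regular_epi C q \<longleftrightarrow> (\<exists>f g. is_coequalizer C f g q)"

text \<open>Squares are given in the order top \<open>t : P \<rightarrow> Y\<close>, left \<open>l : P \<rightarrow> X\<close>, right \<open>r : Y \<rightarrow> Z\<close>,
  bottom \<open>b : X \<rightarrow> Z\<close>.\<close>

definition comm_square :: "('o, 'm) cat \<Rightarrow> 'm \<Rightarrow> 'm \<Rightarrow> 'm \<Rightarrow> 'm \<Rightarrow> bool" where
  "comm_square C t l r b \<longleftrightarrow> {t, l, r, b} \<subseteq> Arr C \<and>
     Dom C t = Dom C l \<and> Cod C t = Dom C r \<and> Cod C l = Dom C b \<and> Cod C r = Cod C b \<and>
     r \<cdot>\<^bsub>C\<^esub> t = b \<cdot>\<^bsub>C\<^esub> l"

definition is_pullback :: "('o, 'm) cat \<Rightarrow> 'm \<Rightarrow> 'm \<Rightarrow> 'm \<Rightarrow> 'm \<Rightarrow> bool" where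
  "is_pullback C t l r b \<longleftrightarrow> comm_square C t l r b \<and>
     (\<forall>t' l'. comm_square C t' l' r b \<longrightarrow>
        (\<exists>!h. h \<in> hom C (Dom C t') (Dom C t) \<and> t \<cdot>\<^bsub>C\<^esub> h = t' \<and> l \<cdot>\<^bsub>C\<^esub> h = l'))"

definition feeble_pullback :: "('o, 'm) cat \<Rightarrow> 'm \<Rightarrow> 'm \<Rightarrow> 'm \<Rightarrow> 'm \<Rightarrow> bool" where
  "feeble_pullback C t l r b \<longleftrightarrow> comm_square C t l r b \<and>
     (\<forall>t' l' u. is_pullback C t' l' r b \<and> u \<in> hom C (Dom C t) (Dom C t') \<and>
        t' \<cdot>\<^bsub>C\<^esub> u = t \<and> l' \<cdot>\<^bsub>C\<^esub> u = l \<longrightarrow> regular_epi C u)"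

definition is_kernel_pair :: "('o, 'm) cat \<Rightarrow> 'm \<Rightarrow> 'm \<Rightarrow> 'm \<Rightarrow> bool" where
  "is_kernel_pair C d0 d1 f \<longleftrightarrow> is_pullback C d1 d0 f f"


section \<open>Regular and exact categories\<close>

definition regular_category :: "('o, 'm) cat \<Rightarrow> bool" where
  "regular_category C \<longleftrightarrow> finitely_complete C \<and>
     (\<forall>d0 d1 f. is_kernel_pair C d0 d1 f \<longrightarrow> (\<exists>q. is_coequalizer C d0 d1 q)) \<and>
     (\<forall>t l r b. is_pullback C t l r b \<and> regular_epi C r \<longrightarrow> regular_epi C l)"

text \<open>An internal equivalence relation \<open>(d0, d1) : R \<rightarrow> X\<close>: jointly monic, reflexive, symmetric and
  transitive. In the last clause \<open>(p, q)\<close> is the pullback of \<open>d1\<close> and \<open>d0\<close>, i.e. the object of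
  composable pairs.\<close>

definition internal_equivalence :: "('o, 'm) cat \<Rightarrow> 'm \<Rightarrow> 'm \<Rightarrow> bool" where
  "internal_equivalence C d0 d1 \<longleftrightarrow>
     d0 \<in> Arr C \<and> d1 \<in> hom C (Dom C d0) (Cod C d0) \<and>
     (\<forall>W. \<forall>f \<in> hom C W (Dom C d0). \<forall>g \<in> hom C W (Dom C d0).
        d0 \<cdot>\<^bsub>C\<^esub> f = d0 \<cdot>\<^bsub>C\<^esub> g \<and> d1 \<cdot>\<^bsub>C\<^esub> f = d1 \<cdot>\<^bsub>C\<^esub> g \<longrightarrow> f = g) \<and>
     (\<exists>s \<in> hom C (Cod C d0) (Dom C d0).
        d0 \<cdot>\<^bsub>C\<^esub> s = Ident C (Cod C d0) \<and> d1 \<cdot>\<^bsub>C\<^esub> s = Ident C (Cod C d0)) \<and>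
     (\<exists>t \<in> hom C (Dom C d0) (Dom C d0). d0 \<cdot>\<^bsub>C\<^esub> t = d1 \<and> d1 \<cdot>\<^bsub>C\<^esub> t = d0) \<and>
     (\<forall>p q. is_pullback C q p d0 d1 \<longrightarrow>
        (\<exists>c \<in> hom C (Dom C p) (Dom C d0).
           d0 \<cdot>\<^bsub>C\<^esub> c = d0 \<cdot>\<^bsub>C\<^esub> p \<and> d1 \<cdot>\<^bsub>C\<^esub> c = d1 \<cdot>\<^bsub>C\<^esub> q))"

definition exact_category :: "('o, 'm) cat \<Rightarrow> bool" where
  "exact_category C \<longleftrightarrow> regular_category C \<and>
     (\<forall>d0 d1. internal_equivalence C d0 d1 \<longrightarrow> (\<exists>f. is_kernel_pair C d0 d1 f))"


section \<open>Coproducts and Condition P\<close>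

definition is_coproduct ::
  "('o, 'm) cat \<Rightarrow> 'i set \<Rightarrow> ('i \<Rightarrow> 'o) \<Rightarrow> 'o \<Rightarrow> ('i \<Rightarrow> 'm) \<Rightarrow> bool" where
  "is_coproduct C I X Q \<iota> \<longleftrightarrow> Q \<in> Obj C \<and> (\<forall>i \<in> I. \<iota> i \<in> hom C (X i) Q) \<and>
     (\<forall>Z \<in> Obj C. \<forall>f. (\<forall>i \<in> I. f i \<in> hom C (X i) Z) \<longrightarrow>
        (\<exists>!h. h \<in> hom C Q Z \<and> (\<forall>i \<in> I. h \<cdot>\<^bsub>C\<^esub> \<iota> i = f i)))"

text \<open>The index sets are finite sets of natural numbers; the empty one gives an initial object.\<close>

definition has_finite_coproducts :: "('o, 'm) cat \<Rightarrow> bool" where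
  "has_finite_coproducts C \<longleftrightarrow> (\<forall>(I :: nat set) X. finite I \<and> X ` I \<subseteq> Obj C \<longrightarrow>
     (\<exists>Q \<iota>. is_coproduct C I X Q \<iota>))"

definition is_binary_coproduct :: "('o, 'm) cat \<Rightarrow> 'o \<Rightarrow> 'o \<Rightarrow> 'm \<times> 'm \<Rightarrow> bool" where
  "is_binary_coproduct C A B = (\<lambda>(i, j).
     i \<in> Arr C \<and> j \<in> Arr C \<and> Dom C i = A \<and> Dom C j = B \<and> Cod C i = Cod C j \<and>
     (\<forall>Z. \<forall>f \<in> hom C A Z. \<forall>g \<in> hom C B Z.
        (\<exists>!h. h \<in> hom C (Cod C i) Z \<and> h \<cdot>\<^bsub>C\<^esub> i = f \<and> h \<cdot>\<^bsub>C\<^esub> j = g)))"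

text \<open>A chosen coproduct \<open>A + B\<close> with its injections; meaningful when one exists.\<close>

definition injections :: "('o, 'm) cat \<Rightarrow> 'o \<Rightarrow> 'o \<Rightarrow> 'm \<times> 'm" where
  "injections C A B = (SOME ij. is_binary_coproduct C A B ij)"

definition inl :: "('o, 'm) cat \<Rightarrow> 'o \<Rightarrow> 'o \<Rightarrow> 'm" where
  "inl C A B = fst (injections C A B)"

definition inr :: "('o, 'm) cat \<Rightarrow> 'o \<Rightarrow> 'o \<Rightarrow> 'm" where
  "inr C A B = snd (injections C A B)"

text \<open>\<open>copair C f g\<close> is \<open>[f, g] : A + B \<rightarrow> Z\<close> and \<open>plus_arr C f g\<close> is \<open>f + g : A + B \<rightarrow> A' + B'\<close>.\<close>

definition copair :: "('o, 'm) cat \<Rightarrow> 'm \<Rightarrow> 'm \<Rightarrow> 'm" where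
  "copair C f g = (THE h. h \<in> hom C (Cod C (inl C (Dom C f) (Dom C g))) (Cod C f) \<and>
     h \<cdot>\<^bsub>C\<^esub> inl C (Dom C f) (Dom C g) = f \<and> h \<cdot>\<^bsub>C\<^esub> inr C (Dom C f) (Dom C g) = g)"

definition plus_arr :: "('o, 'm) cat \<Rightarrow> 'm \<Rightarrow> 'm \<Rightarrow> 'm" where
  "plus_arr C f g = copair C (inl C (Cod C f) (Cod C g) \<cdot>\<^bsub>C\<^esub> f) (inr C (Cod C f) (Cod C g) \<cdot>\<^bsub>C\<^esub> g)"

definition condition_P :: "('o, 'm) cat \<Rightarrow> bool" where
  "condition_P C \<longleftrightarrow> finitely_complete C \<and>
     has_finite_coproducts C \<and>
     (\<forall>t l r b t' l' r' b'. is_pullback C t l r b \<and> is_pullback C t' l' r' b' \<longrightarrow>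
        is_pullback C (plus_arr C t t') (plus_arr C l l') (plus_arr C r r') (plus_arr C b b')) \<and>
     (\<forall>S A m. m \<in> hom C S A \<and> monic C m \<longrightarrow>
        is_pullback C (plus_arr C m (Ident C S)) (copair C (Ident C S) (Ident C S))
          (copair C (Ident C A) m) m) \<and>
     (\<forall>E B p. p \<in> hom C E B \<and> regular_epi C p \<longrightarrow>
        feeble_pullback C (plus_arr C p p) (copair C (Ident C E) (Ident C E))
          (copair C (Ident C B) (Ident C B)) p)"


section \<open>Points and protomodularity\<close>

text \<open>A morphism of points is an arrow of \<open>D\<close> together with its domain and codomain.\<close>

type_synonym ('o, 'm) point = "'o \<times> 'm \<times> 'm"

definition points :: "('o, 'm) cat \<Rightarrow> 'o \<Rightarrow> ('o, 'm) point set" where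
  "points D B = {(A, \<alpha>, \<beta>). A \<in> Obj D \<and> \<alpha> \<in> hom D A B \<and> \<beta> \<in> hom D B A \<and> \<alpha> \<cdot>\<^bsub>D\<^esub> \<beta> = Ident D B}"

definition Pt :: "('o, 'm) cat \<Rightarrow> 'o \<Rightarrow>
    (('o, 'm) point, ('o, 'm) point \<times> 'm \<times> ('o, 'm) point) cat" where
  "Pt D B = \<lparr>
     Obj = points D B,
     Arr = {((A, \<alpha>, \<beta>), f, (A', \<alpha>', \<beta>')) |A \<alpha> \<beta> f A' \<alpha>' \<beta>'.
              (A, \<alpha>, \<beta>) \<in> points D B \<and> (A', \<alpha>', \<beta>') \<in> points D B \<and>
              f \<in> hom D A A' \<and> \<alpha>' \<cdot>\<^bsub>D\<^esub> f = \<alpha> \<and> f \<cdot>\<^bsub>D\<^esub> \<beta> = \<beta>'},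
     Dom = (\<lambda>(X, f, Y). X),
     Cod = (\<lambda>(X, f, Y). Y),
     Ident = (\<lambda>(A, \<alpha>, \<beta>). ((A, \<alpha>, \<beta>), Ident D A, (A, \<alpha>, \<beta>))),
     Comp = (\<lambda>(Y, g, Z) (X, f, Y'). (X, g \<cdot>\<^bsub>D\<^esub> f, Z))\<rparr>"

text \<open>A chosen pullback \<open>(\<pi>1, \<pi>2)\<close> of \<open>p : E \<rightarrow> B\<close> and \<open>\<alpha> : A \<rightarrow> B\<close> with \<open>\<pi>1\<close> into \<open>E\<close> and \<open>\<pi>2\<close> into
  \<open>A\<close>; meaningful when one exists. Its vertex \<open>E \<times>\<^sub>B A\<close> is \<open>Dom D \<pi>1\<close>.\<close>

definition projections :: "('o, 'm) cat \<Rightarrow> 'm \<Rightarrow> 'm \<Rightarrow> 'm \<times> 'm" where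
  "projections D p \<alpha> = (SOME (\<pi>1, \<pi>2). is_pullback D \<pi>2 \<pi>1 \<alpha> p)"

definition pb_pair :: "('o, 'm) cat \<Rightarrow> 'm \<times> 'm \<Rightarrow> 'm \<Rightarrow> 'm \<Rightarrow> 'm" where
  "pb_pair D = (\<lambda>(\<pi>1, \<pi>2) x y. THE h. h \<in> hom D (Dom D x) (Dom D \<pi>1) \<and>
     \<pi>1 \<cdot>\<^bsub>D\<^esub> h = x \<and> \<pi>2 \<cdot>\<^bsub>D\<^esub> h = y)"

definition pullback_point :: "('o, 'm) cat \<Rightarrow> 'm \<Rightarrow> ('o, 'm) point \<Rightarrow> ('o, 'm) point" where
  "pullback_point D p = (\<lambda>(A, \<alpha>, \<beta>). let (\<pi>1, \<pi>2) = projections D p \<alpha> in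
     (Dom D \<pi>1, \<pi>1, pb_pair D (\<pi>1, \<pi>2) (Ident D (Dom D p)) (\<beta> \<cdot>\<^bsub>D\<^esub> p)))"

text \<open>On a morphism \<open>f : (A, \<alpha>, \<beta>) \<rightarrow> (A', \<alpha>', \<beta>')\<close> the pullback functor is \<open>1 \<times> f\<close>, i.e.
  \<open>\<langle>\<pi>1, f \<cdot> \<pi>2\<rangle>\<close>.\<close>

definition pullback_functor :: "('o, 'm) cat \<Rightarrow> 'm \<Rightarrow>
    (('o, 'm) point, ('o, 'm) point \<times> 'm \<times> ('o, 'm) point,
     ('o, 'm) point, ('o, 'm) point \<times> 'm \<times> ('o, 'm) point) func" where
  "pullback_functor D p = \<lparr>
     FObj = pullback_point D p,
     FArr = (\<lambda>((A, \<alpha>, \<beta>), f, (A', \<alpha>', \<beta>')).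
       (pullback_point D p (A, \<alpha>, \<beta>),
        (let (\<pi>1, \<pi>2) = projections D p \<alpha> in pb_pair D (projections D p \<alpha>') \<pi>1 (f \<cdot>\<^bsub>D\<^esub> \<pi>2)),
        pullback_point D p (A', \<alpha>', \<beta>')))\<rparr>"

definition reflects_isos ::
  "('a, 'b) cat \<Rightarrow> ('o, 'm) cat \<Rightarrow> ('a, 'b, 'o, 'm) func \<Rightarrow> bool" where
  "reflects_isos J K F \<longleftrightarrow> (\<forall>f \<in> Arr J. iso K (FArr F f) \<longrightarrow> iso J f)"

definition has_split_epi_pullbacks :: "('o, 'm) cat \<Rightarrow> bool" where
  "has_split_epi_pullbacks D \<longleftrightarrow> (\<forall>p \<alpha>. p \<in> Arr D \<and> split_epi D \<alpha> \<and> Cod D \<alpha> = Cod D p \<longrightarrow>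
     (\<exists>\<pi>1 \<pi>2. is_pullback D \<pi>2 \<pi>1 \<alpha> p))"

definition protomodular :: "('o, 'm) cat \<Rightarrow> bool" where
  "protomodular D \<longleftrightarrow> category D \<and> has_split_epi_pullbacks D \<and>
     (\<forall>E B. \<forall>p \<in> hom D E B. reflects_isos (Pt D B) (Pt D E) (pullback_functor D p))"

definition coprotomodular :: "('o, 'm) cat \<Rightarrow> bool" where
  "coprotomodular C \<longleftrightarrow> protomodular (opp C)"

end

theory Submission
  imports Defs
begin

text \<open>A pushout of a split monomorphism \<open>\<alpha> : B \<rightarrow> A\<close> along \<open>p : B \<rightarrow> E\<close> is also a pushout of \<open>1 + \<alpha>\<close> along the
  split epimorphism \<open>[1, p] : E + B \<rightarrow> E\<close>, so only regular epimorphisms \<open>p\<close> matter. Let \<open>(r1, r2)\<close> be the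
  kernel pair of \<open>p\<close>, with vertex \<open>R\<close>. Two elements \<open>x, y\<close> of \<open>A\<close> should be identified in the pushout if
  locally there is \<open>w\<close> in \<open>A + R\<close> with \<open>[1, \<alpha> r1] w = x\<close> and \<open>[1, \<alpha> r2] w = y\<close>. Condition P makes this
  relation transitive, so by exactness it is the kernel pair of its coequalizer \<open>q : A \<rightarrow> P\<close>.

  Now let \<open>f : A \<rightarrow> A'\<close> be a morphism of points inducing an isomorphism of pushouts. The maps \<open>q\<close> and the
  retraction \<open>\<beta> : A \<rightarrow> B\<close> are jointly monic, by (c) for the diagonal \<open>B \<rightarrow> R\<close>, hence \<open>f\<close> is monic. Every
  \<open>a'\<close> in \<open>A'\<close> is locally related to some \<open>f a\<close> by a \<open>w\<close> in \<open>A' + R\<close>; then (c) for \<open>f\<close> and (b) show that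
  \<open>w\<close> lies in \<open>A + R\<close>, and so \<open>a'\<close> lies in the image of \<open>f\<close>.\<close>

section \<open>Categories with finite limits and coproducts\<close>

context category
begin

section \<open>Equational calculus of arrows\<close>

lemma hom_iff: "f \<in> hom C A B \<longleftrightarrow> f \<in> Arr C \<and> Dom C f = A \<and> Cod C f = B"
  by (simp add: hom_def)

lemma comp_arr [simp]:
  assumes "f \<in> Arr C" "g \<in> Arr C" "Dom C g = Cod C f"
  shows "g \<cdot> f \<in> Arr C" "Dom C (g \<cdot> f) = Dom C f" "Cod C (g \<cdot> f) = Cod C g"
  using Comp_hom[of f "Dom C f" "Cod C f" g "Cod C g"] assms by (auto simp: hom_iff)

lemma ident_arr [simp]:
  assumes "A \<in> Obj C"
  shows "Ident C A \<in> Arr C" "Dom C (Ident C A) = A" "Cod C (Ident C A) = A"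
  using Id_hom[OF assms] by (auto simp: hom_iff)

lemma ident_left [simp]: "f \<in> Arr C \<Longrightarrow> Cod C f = Y \<Longrightarrow> Ident C Y \<cdot> f = f"
  using Comp_Id_left[of f "Dom C f" Y] by (simp add: hom_iff)

lemma ident_right [simp]: "f \<in> Arr C \<Longrightarrow> Dom C f = X \<Longrightarrow> f \<cdot> Ident C X = f"
  using Comp_Id_right[of f X "Cod C f"] by (simp add: hom_iff)

lemma assoc [simp]:
  "f \<in> Arr C \<Longrightarrow> g \<in> Arr C \<Longrightarrow> h \<in> Arr C \<Longrightarrow> Dom C g = Cod C f \<Longrightarrow> Dom C h = Cod C g
    \<Longrightarrow> (h \<cdot> g) \<cdot> f = h \<cdot> (g \<cdot> f)"
  using Comp_assoc[of f "Dom C f" "Cod C f" g "Cod C g" h "Cod C h"] by (simp add: hom_iff)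

lemma hom_objD: "f \<in> hom C A B \<Longrightarrow> A \<in> Obj C" "f \<in> hom C A B \<Longrightarrow> B \<in> Obj C"
  using Dom_Obj Cod_Obj by (auto simp: hom_iff)

lemma homD:
  assumes "f \<in> hom C A B"
  shows "f \<in> Arr C" "Dom C f = A" "Cod C f = B" "A \<in> Obj C" "B \<in> Obj C"
  using assms hom_objD[OF assms] by (auto simp: hom_iff)

text \<open>The simplifier associates composites to the right, and there an equation between
  composites of two arrows no longer matches. This form uses such an equation when a further arrow
  \<open>f\<close> is precomposed; \<open>comp_cong1\<close> does so when one side is a single
  arrow.\<close>

lemma comp_cong:
  assumes "h \<cdot> g = k \<cdot> l"
    and "f \<in> Arr C" "g \<in> Arr C" "h \<in> Arr C" "Dom C g = Cod C f" "Dom C h = Cod C g"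
    and "l \<in> Arr C" "k \<in> Arr C" "Dom C l = Cod C f" "Dom C k = Cod C l"
  shows "h \<cdot> (g \<cdot> f) = k \<cdot> (l \<cdot> f)"
  using assoc[of f g h] assoc[of f l k] assms by simp

lemma comp_cong1:
  assumes "h \<cdot> g = k"
    and "f \<in> Arr C" "g \<in> Arr C" "h \<in> Arr C" "Dom C g = Cod C f" "Dom C h = Cod C g"
  shows "h \<cdot> (g \<cdot> f) = k \<cdot> f"
  using assoc[of f g h] assms by simp

section \<open>Pullbacks\<close>

lemma pullbackD:
  assumes "is_pullback C t l r b"
  shows "t \<in> Arr C" "l \<in> Arr C" "r \<in> Arr C" "b \<in> Arr C" "Dom C l = Dom C t"
    "Cod C t = Dom C r" "Cod C l = Dom C b" "Cod C r = Cod C b" "r \<cdot> t = b \<cdot> l"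
  using assms by (auto simp: is_pullback_def comm_square_def)

lemma pullback_lift:
  assumes "is_pullback C t l r b" "x \<in> hom C W (Dom C r)" "y \<in> hom C W (Dom C b)" "r \<cdot> x = b \<cdot> y"
  obtains w where "w \<in> hom C W (Dom C t)" "t \<cdot> w = x" "l \<cdot> w = y"
proof -
  have "comm_square C x y r b"
    using assms pullbackD[OF assms(1)] by (auto simp: comm_square_def hom_iff)
  then obtain w where "w \<in> hom C (Dom C x) (Dom C t) \<and> t \<cdot> w = x \<and> l \<cdot> w = y"
    using assms(1) unfolding is_pullback_def by blast
  then show ?thesis using that assms(2) by (auto simp: hom_iff)
qed

lemma pullback_ext:
  assumes pb: "is_pullback C t l r b"
    and u: "u \<in> hom C W (Dom C t)" and v: "v \<in> hom C W (Dom C t)"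
    and eq: "t \<cdot> u = t \<cdot> v" "l \<cdot> u = l \<cdot> v"
  shows "u = v"
proof -
  note [simp] = pullbackD[OF pb]
  have [simp]: "u \<in> Arr C" "v \<in> Arr C" "Dom C u = W" "Dom C v = W"
    "Cod C u = Dom C t" "Cod C v = Dom C t" using u v by (auto simp: hom_iff)
  have "r \<cdot> (t \<cdot> u) = b \<cdot> (l \<cdot> u)"
    by (rule comp_cong) (simp_all)
  then have "comm_square C (t \<cdot> u) (l \<cdot> u) r b"
    by (simp add: comm_square_def)
  then have "\<exists>!h. h \<in> hom C (Dom C (t \<cdot> u)) (Dom C t) \<and> t \<cdot> h = t \<cdot> u \<and> l \<cdot> h = l \<cdot> u"
    using pb unfolding is_pullback_def by blast
  then have "\<exists>!h. h \<in> hom C W (Dom C t) \<and> t \<cdot> h = t \<cdot> u \<and> l \<cdot> h = l \<cdot> u"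
    by simp
  then show ?thesis using u v eq by metis
qed

lemma pullbackI:
  assumes "comm_square C t l r b"
    and "\<And>W x y. x \<in> hom C W (Dom C r) \<Longrightarrow> y \<in> hom C W (Dom C b) \<Longrightarrow> r \<cdot> x = b \<cdot> y
      \<Longrightarrow> \<exists>!w. w \<in> hom C W (Dom C t) \<and> t \<cdot> w = x \<and> l \<cdot> w = y"
  shows "is_pullback C t l r b"
  unfolding is_pullback_def
proof (intro conjI allI impI assms(1))
  fix x y assume "comm_square C x y r b"
  then show "\<exists>!h. h \<in> hom C (Dom C x) (Dom C t) \<and> t \<cdot> h = x \<and> l \<cdot> h = y"
    by (intro assms(2)) (auto simp: comm_square_def hom_iff)
qed

text \<open>Every square to which clause (b) is applied later has this trivial square or the one of
  \<open>pullback_ident_rows\<close> as a summand.\<close>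

lemma pullback_ident_sides: "k \<in> hom C X Y \<Longrightarrow> is_pullback C k (Ident C X) (Ident C Y) k"
  using hom_objD[of k X Y] by (intro pullbackI) (auto simp: comm_square_def hom_iff)

lemma pullback_ident_rows: "k \<in> hom C X Y \<Longrightarrow> is_pullback C (Ident C X) k k (Ident C Y)"
  using hom_objD[of k X Y] by (intro pullbackI) (auto simp: comm_square_def hom_iff)

lemma pullback_exists:
  assumes fc: "finitely_complete C"
    and r: "r \<in> hom C Y Z" and b: "b \<in> hom C X Z"
  obtains t l where "is_pullback C t l r b"
proof -
  \<comment> \<open>The cospan category: \<open>0\<close>, \<open>1\<close>, \<open>2\<close> name
    both the objects and their identities, and \<open>3 : 0 -> 2\<close>, \<open>4 : 1 -> 2\<close>
    are the two legs. In a composable pair at most one arrow is a leg, and then it is the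
    composite.\<close>
  define J :: "(nat, nat) cat" where
    "J = \<lparr>Obj = {0,1,2}, Arr = {0,1,2,3,4}, Dom = (\<lambda>n. if n = 3 then 0 else if n = 4 then 1 else n),
      Cod = (\<lambda>n. if n \<ge> 3 then 2 else n), Ident = (\<lambda>n. n), Comp = (\<lambda>g f. if g < 3 then f else g)\<rparr>"
  define F :: "(nat, nat, 'o, 'm) func" where
    "F = \<lparr>FObj = (\<lambda>n. if n = 0 then Y else if n = 1 then X else Z),
      FArr = (\<lambda>n. if n = 0 then Ident C Y else if n = 1 then Ident C X else
         if n = 2 then Ident C Z else if n = 3 then r else b)\<rparr>"
  have [simp]: "r \<in> Arr C" "b \<in> Arr C" "Dom C r = Y" "Cod C r = Z" "Dom C b = X" "Cod C b = Z"
    "X \<in> Obj C" "Y \<in> Obj C" "Z \<in> Obj C"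
    using r b hom_objD[OF r] hom_objD[OF b] by (auto simp: hom_iff)
  have "category J"
    by unfold_locales (auto simp: J_def hom_def split: if_splits)
  then have "is_functor J C F"
    unfolding is_functor_def using category_axioms
    by (auto simp: J_def F_def hom_def split: if_splits)
  moreover have "finite (Arr J)" by (simp add: J_def)
  ultimately obtain L \<pi> where lim: "is_limit J C F L \<pi>"
    using fc unfolding finitely_complete_def by blast
  then have cone: "is_cone J C F L \<pi>" by (simp add: is_limit_def)
  have ty: "\<pi> 0 \<in> hom C L Y" "\<pi> 1 \<in> hom C L X" "\<pi> 2 \<in> hom C L Z" "r \<cdot> \<pi> 0 = \<pi> 2" "b \<cdot> \<pi> 1 = \<pi> 2"
    using cone by (auto simp: is_cone_def J_def F_def)
  have "is_pullback C (\<pi> 0) (\<pi> 1) r b"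
  proof (rule pullbackI)
    show "comm_square C (\<pi> 0) (\<pi> 1) r b"
      using ty by (auto simp: comm_square_def hom_iff)
    fix W x y assume x: "x \<in> hom C W (Dom C r)" and y: "y \<in> hom C W (Dom C b)" and eq: "r \<cdot> x = b \<cdot> y"
    define \<pi>' where "\<pi>' = (\<lambda>n::nat. if n = 0 then x else if n = 1 then y else r \<cdot> x)"
    have "W \<in> Obj C" using hom_objD[OF x] by simp
    then have "is_cone J C F W \<pi>'"
      using x y eq by (auto simp: is_cone_def J_def F_def \<pi>'_def hom_iff)
    then have *: "\<exists>!h. h \<in> hom C W L \<and> (\<forall>j \<in> Obj J. \<pi> j \<cdot> h = \<pi>' j)"
      using lim by (simp add: is_limit_def)
    have "\<pi> 2 \<cdot> h = r \<cdot> x" if "h \<in> hom C W L" "\<pi> 0 \<cdot> h = x" for h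
    proof -
      have "(r \<cdot> \<pi> 0) \<cdot> h = r \<cdot> (\<pi> 0 \<cdot> h)" using that ty(1) by (intro assoc) (auto simp: hom_iff)
      then show ?thesis using that ty by simp
    qed
    then have "(h \<in> hom C W L \<and> (\<forall>j \<in> Obj J. \<pi> j \<cdot> h = \<pi>' j)) \<longleftrightarrow>
        (h \<in> hom C W L \<and> \<pi> 0 \<cdot> h = x \<and> \<pi> 1 \<cdot> h = y)" for h
      by (auto simp: J_def \<pi>'_def)
    with * show "\<exists>!w. w \<in> hom C W (Dom C (\<pi> 0)) \<and> \<pi> 0 \<cdot> w = x \<and> \<pi> 1 \<cdot> w = y"
      using ty(1) by (simp add: hom_iff)
  qed
  then show ?thesis using that by blast
qed

section \<open>Relations, covers and regular epimorphisms\<close>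

definition jointly_monic :: "'m \<Rightarrow> 'm \<Rightarrow> bool" where
  "jointly_monic d0 d1 \<longleftrightarrow> d0 \<in> Arr C \<and> d1 \<in> hom C (Dom C d0) (Cod C d0) \<and>
     (\<forall>W. \<forall>f \<in> hom C W (Dom C d0). \<forall>g \<in> hom C W (Dom C d0).
        d0 \<cdot> f = d0 \<cdot> g \<and> d1 \<cdot> f = d1 \<cdot> g \<longrightarrow> f = g)"

text \<open>Orthogonality to jointly monic pairs, so that existence of a factorization through a relation
  can be checked after passing to a cover. Unlike regularity of epimorphisms, closure of this
  property under composition is immediate.\<close>

definition cover :: "'m \<Rightarrow> bool" where
  "cover e \<longleftrightarrow> e \<in> Arr C \<and> (\<forall>d0 d1 u a b. jointly_monic d0 d1 \<longrightarrow>
     u \<in> hom C (Dom C e) (Dom C d0) \<longrightarrow> a \<in> hom C (Cod C e) (Cod C d0) \<longrightarrow>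
     b \<in> hom C (Cod C e) (Cod C d0) \<longrightarrow> d0 \<cdot> u = a \<cdot> e \<longrightarrow> d1 \<cdot> u = b \<cdot> e \<longrightarrow>
     (\<exists>c \<in> hom C (Cod C e) (Dom C d0). d0 \<cdot> c = a \<and> d1 \<cdot> c = b))"

lemma coequalizerD:
  assumes "is_coequalizer C f g q"
  shows "f \<in> Arr C" "g \<in> Arr C" "Dom C g = Dom C f" "Cod C g = Cod C f" "q \<in> Arr C"
    "Dom C q = Cod C f" "q \<cdot> f = q \<cdot> g"
  using assms by (auto simp: is_coequalizer_def hom_iff)

lemma coequalizer_factor:
  assumes "is_coequalizer C f g q" "h \<in> hom C (Cod C f) Z" "h \<cdot> f = h \<cdot> g"
  obtains k where "k \<in> hom C (Cod C q) Z" "k \<cdot> q = h"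
  using assms unfolding is_coequalizer_def by blast

lemma regular_epi_arr: "regular_epi C q \<Longrightarrow> q \<in> Arr C"
  by (auto simp: regular_epi_def is_coequalizer_def)

lemma coequalizer_epi:
  assumes q: "is_coequalizer C f g q" and h: "h \<in> hom C (Cod C q) Z" "k \<in> hom C (Cod C q) Z"
    and eq: "h \<cdot> q = k \<cdot> q"
  shows "h = k"
proof -
  note [simp] = coequalizerD[OF q]
  have "(h \<cdot> q) \<cdot> f = (h \<cdot> q) \<cdot> g" "h \<cdot> q \<in> hom C (Cod C f) Z"
    using h by (auto simp: hom_iff)
  then have "\<exists>!l. l \<in> hom C (Cod C q) Z \<and> l \<cdot> q = h \<cdot> q"
    using q unfolding is_coequalizer_def by blast
  then show ?thesis using h eq by metis
qed

lemma regular_epi_epi: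
  assumes "regular_epi C q" "h \<in> hom C (Cod C q) Z" "k \<in> hom C (Cod C q) Z" "h \<cdot> q = k \<cdot> q"
  shows "h = k"
  using assms coequalizer_epi unfolding regular_epi_def by blast

text \<open>If \<open>e\<close> coequalizes \<open>f\<close> and \<open>g\<close>, then so does
  \<open>u\<close>, because both components of \<open>u f\<close> and \<open>u g\<close> agree. So
  \<open>u\<close> factors through \<open>e\<close>, and the factor has the required components
  because \<open>e\<close> is epi.\<close>

lemma regular_epi_cover:
  assumes "regular_epi C e" shows "cover e"
  unfolding cover_def
proof (intro conjI allI impI)
  show "e \<in> Arr C" using assms by (rule regular_epi_arr)
  fix d0 d1 u a b
  assume jm: "jointly_monic d0 d1" and u: "u \<in> hom C (Dom C e) (Dom C d0)"
    and a: "a \<in> hom C (Cod C e) (Cod C d0)" and b: "b \<in> hom C (Cod C e) (Cod C d0)"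
    and eq: "d0 \<cdot> u = a \<cdot> e" "d1 \<cdot> u = b \<cdot> e"
  obtain f g where co: "is_coequalizer C f g e" using assms by (auto simp: regular_epi_def)
  note [simp] = coequalizerD[OF co]
  have [simp]: "d0 \<in> Arr C" "d1 \<in> Arr C" "Dom C d1 = Dom C d0" "Cod C d1 = Cod C d0"
    using jm by (auto simp: jointly_monic_def hom_iff)
  have [simp]: "u \<in> Arr C" "a \<in> Arr C" "b \<in> Arr C" "Dom C u = Cod C f" "Dom C a = Cod C e" "Dom C b = Cod C e"
     "Cod C u = Dom C d0" "Cod C a = Cod C d0" "Cod C b = Cod C d0"
    using u a b by (auto simp: hom_iff)
  have "d0 \<cdot> (u \<cdot> x) = a \<cdot> (e \<cdot> x)" "d1 \<cdot> (u \<cdot> x) = b \<cdot> (e \<cdot> x)"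
    if "x \<in> Arr C" "Cod C x = Cod C f" for x
    using that by (auto intro!: comp_cong eq)
  then have "d0 \<cdot> (u \<cdot> f) = d0 \<cdot> (u \<cdot> g)" "d1 \<cdot> (u \<cdot> f) = d1 \<cdot> (u \<cdot> g)"
    by simp_all
  then have "u \<cdot> f = u \<cdot> g"
    using jm unfolding jointly_monic_def by (auto simp: hom_iff)
  then obtain c where c: "c \<in> hom C (Cod C e) (Dom C d0)" "c \<cdot> e = u"
    using coequalizer_factor[OF co, of u] u by auto
  have "d0 \<cdot> c = a" "d1 \<cdot> c = b"
    using coequalizer_epi[OF co, of "d0 \<cdot> c" "Cod C d0" a] coequalizer_epi[OF co, of "d1 \<cdot> c" "Cod C d0" b]
      c eq by (auto simp: hom_iff)
  then show "\<exists>c \<in> hom C (Cod C e) (Dom C d0). d0 \<cdot> c = a \<and> d1 \<cdot> c = b" using c by blast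
qed

lemma cover_comp:
  assumes e: "cover e" and e': "cover e'" and co: "Dom C e = Cod C e'"
  shows "cover (e \<cdot> e')"
  unfolding cover_def
proof (intro conjI allI impI)
  have [simp]: "e \<in> Arr C" "e' \<in> Arr C" using e e' by (auto simp: cover_def)
  show "e \<cdot> e' \<in> Arr C" using co by simp
  fix d0 d1 u a b
  assume jm: "jointly_monic d0 d1" and u: "u \<in> hom C (Dom C (e \<cdot> e')) (Dom C d0)"
    and a: "a \<in> hom C (Cod C (e \<cdot> e')) (Cod C d0)" and b: "b \<in> hom C (Cod C (e \<cdot> e')) (Cod C d0)"
    and eq: "d0 \<cdot> u = a \<cdot> (e \<cdot> e')" "d1 \<cdot> u = b \<cdot> (e \<cdot> e')"
  have "\<exists>c \<in> hom C (Cod C e') (Dom C d0). d0 \<cdot> c = a \<cdot> e \<and> d1 \<cdot> c = b \<cdot> e"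
    using e' jm u a b eq co unfolding cover_def by (auto simp: hom_iff)
  then show "\<exists>c \<in> hom C (Cod C (e \<cdot> e')) (Dom C d0). d0 \<cdot> c = a \<and> d1 \<cdot> c = b"
    using e jm a b co unfolding cover_def by (auto simp: hom_iff)
qed

lemma cover_descent:
  assumes e: "cover e" "e \<in> hom C X Y" and jm: "jointly_monic d0 d1" and d: "d0 \<in> hom C I Z"
    and u: "u \<in> hom C X I" "a \<in> hom C Y Z" "b \<in> hom C Y Z" "d0 \<cdot> u = a \<cdot> e" "d1 \<cdot> u = b \<cdot> e"
  obtains c where "c \<in> hom C Y I" "d0 \<cdot> c = a" "d1 \<cdot> c = b"
proof -
  have [simp]: "Dom C e = X" "Cod C e = Y" "Dom C d0 = I" "Cod C d0 = Z"
    using e(2) d by (auto simp: hom_iff)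
  show ?thesis
    using e(1)[unfolded cover_def, THEN conjunct2, rule_format, OF jm, of u a b] u that by auto
qed

text \<open>A split epimorphism \<open>p\<close> with section \<open>s\<close> is the coequalizer of
  the identity and the idempotent \<open>s p\<close>.\<close>

lemma split_epi_regular_epi:
  assumes p: "p \<in> hom C X Y" and s: "s \<in> hom C Y X" and ps: "p \<cdot> s = Ident C Y"
  shows "regular_epi C p"
proof -
  have [simp]: "p \<in> Arr C" "s \<in> Arr C" "Dom C p = X" "Cod C p = Y" "Dom C s = Y" "Cod C s = X" "X \<in> Obj C" "Y \<in> Obj C"
    using p s hom_objD[OF p] by (auto simp: hom_iff)
  have psx: "p \<cdot> (s \<cdot> x) = x" if "x \<in> Arr C" "Cod C x = Y" for x
    using comp_cong1[OF ps, of x] that by simp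
  have "is_coequalizer C (Ident C X) (s \<cdot> p) p"
    unfolding is_coequalizer_def
  proof (intro conjI allI ballI impI)
    fix Z h assume h: "h \<in> hom C (Cod C (Ident C X)) Z" "h \<cdot> Ident C X = h \<cdot> (s \<cdot> p)"
    have [simp]: "h \<in> Arr C" "Dom C h = X" "Cod C h = Z" using h by (auto simp: hom_iff)
    show "\<exists>!k. k \<in> hom C (Cod C p) Z \<and> k \<cdot> p = h"
    proof (rule ex1I[of _ "h \<cdot> s"])
      show "h \<cdot> s \<in> hom C (Cod C p) Z \<and> (h \<cdot> s) \<cdot> p = h" using h by (simp add: hom_iff)
      fix k assume "k \<in> hom C (Cod C p) Z \<and> k \<cdot> p = h"
      then show "k = h \<cdot> s" using ps by (auto simp: hom_iff)
    qed
  qed (auto simp: hom_iff psx)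
  then show ?thesis by (auto simp: regular_epi_def)
qed

text \<open>Any pair with coequalizer \<open>p\<close> factors through the kernel pair, so an arrow
  coequalizing the kernel pair coequalizes that pair too.\<close>

lemma regular_epi_coequalizer_kernel_pair:
  assumes p: "regular_epi C p" and kp: "is_pullback C r2 r1 p p"
  shows "is_coequalizer C r1 r2 p"
proof -
  obtain f g where co: "is_coequalizer C f g p" using p by (auto simp: regular_epi_def)
  note [simp] = coequalizerD[OF co]
  note kpD = pullbackD[OF kp]
  obtain t where t: "t \<in> hom C (Dom C f) (Dom C r2)" "r2 \<cdot> t = g" "r1 \<cdot> t = f"
    by (rule pullback_lift[OF kp, of g "Dom C f" f]) (auto simp: hom_iff)
  show ?thesis
    unfolding is_coequalizer_def
  proof (intro conjI allI ballI impI)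
    fix Z h assume h: "h \<in> hom C (Cod C r1) Z" "h \<cdot> r1 = h \<cdot> r2"
    have "h \<cdot> (r1 \<cdot> t) = h \<cdot> (r2 \<cdot> t)"
      by (rule comp_cong) (use h t kpD in \<open>auto simp: hom_iff\<close>)
    then have "h \<cdot> f = h \<cdot> g" using t by simp
    moreover have "h \<in> hom C (Cod C f) Z" using h kpD by simp
    ultimately show "\<exists>!k. k \<in> hom C (Cod C p) Z \<and> k \<cdot> p = h"
      using co unfolding is_coequalizer_def by blast
  qed (use kpD in \<open>auto simp: hom_iff\<close>)
qed

end

locale exact_condition_P = category C for C :: "('o, 'm) cat" (structure) +
  assumes exact: "exact_category C" and condP: "condition_P C"
begin

abbreviation coprod :: "'o \<Rightarrow> 'o \<Rightarrow> 'o" (infixl "\<oplus>" 65) where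
  "A \<oplus> B \<equiv> Cod C (inl C A B)"

lemma fin_complete: "finitely_complete C"
  using condP by (simp add: condition_P_def)

section \<open>Calculus of binary coproducts\<close>

lemma binary_coproduct:
  assumes "A \<in> Obj C" "B \<in> Obj C"
  shows "is_binary_coproduct C A B (inl C A B, inr C A B)"
proof -
  define X :: "nat \<Rightarrow> 'o" where "X = (\<lambda>n. if n = 0 then A else B)"
  have "finite {0::nat, 1} \<and> X ` {0, 1} \<subseteq> Obj C" using assms by (simp add: X_def)
  then obtain Q \<iota> where co: "is_coproduct C {0::nat, 1} X Q \<iota>"
    using condP unfolding condition_P_def has_finite_coproducts_def by blast
  have i: "\<iota> 0 \<in> hom C A Q" "\<iota> 1 \<in> hom C B Q"
    using co by (auto simp: is_coproduct_def X_def)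
  note [simp] = homD[OF i(1)] homD[OF i(2)]
  have "is_binary_coproduct C A B (\<iota> 0, \<iota> 1)"
    unfolding is_binary_coproduct_def prod.case
  proof (intro conjI allI ballI)
    fix Z f g assume f: "f \<in> hom C A Z" and g: "g \<in> hom C B Z"
    define F :: "nat \<Rightarrow> 'm" where "F = (\<lambda>n. if n = 0 then f else g)"
    have "Z \<in> Obj C" "\<forall>i \<in> {0, 1}. F i \<in> hom C (X i) Z"
      using f g homD[OF f] by (auto simp: F_def X_def)
    then have "\<exists>!h. h \<in> hom C Q Z \<and> (\<forall>i \<in> {0, 1}. h \<cdot> \<iota> i = F i)"
      using co unfolding is_coproduct_def by blast
    then show "\<exists>!h. h \<in> hom C (Cod C (\<iota> 0)) Z \<and> h \<cdot> \<iota> 0 = f \<and> h \<cdot> \<iota> 1 = g"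
      by (simp add: F_def)
  qed (simp_all del: One_nat_def)
  then have "is_binary_coproduct C A B (injections C A B)"
    unfolding injections_def by (rule someI)
  then show ?thesis by (simp add: inl_def inr_def)
qed

lemma inj_arr [simp]:
  assumes "A \<in> Obj C" "B \<in> Obj C"
  shows "inl C A B \<in> Arr C" "inr C A B \<in> Arr C" "Dom C (inl C A B) = A" "Dom C (inr C A B) = B"
    "Cod C (inr C A B) = A \<oplus> B" "A \<oplus> B \<in> Obj C"
  using binary_coproduct[OF assms] Cod_Obj by (auto simp: is_binary_coproduct_def)

lemma copair_ex1:
  assumes "f \<in> hom C A Z" "g \<in> hom C B Z"
  shows "\<exists>!h. h \<in> hom C (A \<oplus> B) Z \<and> h \<cdot> inl C A B = f \<and> h \<cdot> inr C A B = g"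
  using binary_coproduct[of A B] homD[OF assms(1)] homD[OF assms(2)] assms
  unfolding is_binary_coproduct_def prod.case by blast

lemma copair_ext:
  assumes "h \<in> hom C (A \<oplus> B) Z" "k \<in> hom C (A \<oplus> B) Z" "A \<in> Obj C" "B \<in> Obj C"
    and "h \<cdot> inl C A B = k \<cdot> inl C A B" "h \<cdot> inr C A B = k \<cdot> inr C A B"
  shows "h = k"
proof -
  note [simp] = homD[OF assms(2)]
  have "k \<cdot> inl C A B \<in> hom C A Z" "k \<cdot> inr C A B \<in> hom C B Z"
    using assms(3,4) by (simp_all add: hom_iff)
  from copair_ex1[OF this] show ?thesis using assms by metis
qed

lemma copair_props:
  assumes "f \<in> Arr C" "g \<in> Arr C" "Cod C f = Cod C g"
  shows "copair C f g \<in> hom C (Dom C f \<oplus> Dom C g) (Cod C f) \<and>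
    copair C f g \<cdot> inl C (Dom C f) (Dom C g) = f \<and> copair C f g \<cdot> inr C (Dom C f) (Dom C g) = g"
  unfolding copair_def
  by (rule theI', rule copair_ex1) (use assms in \<open>auto simp: hom_iff\<close>)

lemma copair_arr [simp]:
  assumes "f \<in> Arr C" "g \<in> Arr C" "Cod C f = Cod C g"
  shows "copair C f g \<in> Arr C" "Dom C (copair C f g) = Dom C f \<oplus> Dom C g" "Cod C (copair C f g) = Cod C f"
  using copair_props[OF assms] by (auto simp: hom_iff)

lemma copair_inj [simp]:
  assumes "f \<in> Arr C" "g \<in> Arr C" "Cod C f = Cod C g" "Dom C f = A" "Dom C g = B"
  shows "copair C f g \<cdot> inl C A B = f" "copair C f g \<cdot> inr C A B = g"
  using copair_props[OF assms(1,2,3)] assms(4,5) by auto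

lemma copair_inj_comp [simp]:
  assumes "f \<in> Arr C" "g \<in> Arr C" "Cod C f = Cod C g" "Dom C f = A" "Dom C g = B" "A \<in> Obj C" "B \<in> Obj C"
  shows "x \<in> Arr C \<Longrightarrow> Cod C x = A \<Longrightarrow> copair C f g \<cdot> (inl C A B \<cdot> x) = f \<cdot> x"
    and "y \<in> Arr C \<Longrightarrow> Cod C y = B \<Longrightarrow> copair C f g \<cdot> (inr C A B \<cdot> y) = g \<cdot> y"
proof -
  show "x \<in> Arr C \<Longrightarrow> Cod C x = A \<Longrightarrow> copair C f g \<cdot> (inl C A B \<cdot> x) = f \<cdot> x"
    by (rule comp_cong1) (simp_all add: assms)
  show "y \<in> Arr C \<Longrightarrow> Cod C y = B \<Longrightarrow> copair C f g \<cdot> (inr C A B \<cdot> y) = g \<cdot> y"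
    by (rule comp_cong1) (simp_all add: assms)
qed

lemma comp_copair [simp]:
  assumes "f \<in> Arr C" "g \<in> Arr C" "k \<in> Arr C" "Cod C f = Cod C g" "Dom C k = Cod C g"
  shows "k \<cdot> copair C f g = copair C (k \<cdot> f) (k \<cdot> g)"
  by (rule copair_ext[of _ "Dom C f" "Dom C g" "Cod C k"])
    (use assms Dom_Obj[OF assms(1)] Dom_Obj[OF assms(2)] in \<open>auto simp: hom_iff\<close>)

lemma comp_copair_comp [simp]:
  assumes "f \<in> Arr C" "g \<in> Arr C" "k \<in> Arr C" "Cod C f = Cod C g" "Dom C k = Cod C g"
    and "x \<in> Arr C" "Cod C x = Dom C f \<oplus> Dom C g"
  shows "k \<cdot> (copair C f g \<cdot> x) = copair C (k \<cdot> f) (k \<cdot> g) \<cdot> x"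
  by (rule comp_cong1) (use assms in auto)

lemma copair_inl_inr [simp]:
  assumes "A \<in> Obj C" "B \<in> Obj C"
  shows "copair C (inl C A B) (inr C A B) = Ident C (A \<oplus> B)"
  by (rule copair_ext[of _ A B "A \<oplus> B"]) (use assms in \<open>auto simp: hom_iff\<close>)

section \<open>Condition P, regularity and images in terms of generalized elements\<close>

declare plus_arr_def [simp]

text \<open>Clause (b) for elements. For the two trivial squares of \<open>m : S -> A\<close> and
  \<open>k : R -> X\<close> it says: an element of \<open>A + R\<close> whose image under
  \<open>1 + k\<close> comes from \<open>S + X\<close> along \<open>m + 1\<close> itself comes from
  \<open>S + R\<close>.\<close>

lemma coproduct_pullback_lift:
  assumes pb: "is_pullback C t l r b" "is_pullback C t' l' r' b'"
    and x: "x \<in> hom C W (Dom C r \<oplus> Dom C r')" and y: "y \<in> hom C W (Dom C b \<oplus> Dom C b')"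
    and eq: "plus_arr C r r' \<cdot> x = plus_arr C b b' \<cdot> y"
  obtains w where "w \<in> hom C W (Dom C t \<oplus> Dom C t')" "plus_arr C t t' \<cdot> w = x" "plus_arr C l l' \<cdot> w = y"
proof -
  have pp: "is_pullback C (plus_arr C t t') (plus_arr C l l') (plus_arr C r r') (plus_arr C b b')"
    using condP pb unfolding condition_P_def by blast
  note [simp] = pullbackD(1-8)[OF pb(1)] pullbackD(1-8)[OF pb(2)]
  have [simp]: "Dom C r \<in> Obj C" "Dom C r' \<in> Obj C" "Cod C b \<in> Obj C" "Cod C b' \<in> Obj C"
    using Dom_Obj Cod_Obj by simp_all
  show ?thesis
    by (rule pullback_lift[OF pp, of x W y]) (use x y eq that in simp_all)
qed

text \<open>Clause (c) for elements: as soon as \<open>[1, m] x\<close> lies in \<open>S\<close>,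
  the \<open>A\<close>-part of \<open>x\<close> lies in \<open>S\<close>.\<close>

lemma mono_coproduct_lift:
  assumes m: "m \<in> hom C S A" "monic C m"
    and x: "x \<in> hom C W (A \<oplus> S)" and y: "y \<in> hom C W S"
    and eq: "copair C (Ident C A) m \<cdot> x = m \<cdot> y"
  obtains z where "z \<in> hom C W (S \<oplus> S)" "plus_arr C m (Ident C S) \<cdot> z = x"
    "copair C (Ident C S) (Ident C S) \<cdot> z = y"
proof -
  have pb: "is_pullback C (plus_arr C m (Ident C S)) (copair C (Ident C S) (Ident C S))
          (copair C (Ident C A) m) m"
    using condP m unfolding condition_P_def by blast
  note [simp] = homD[OF m(1)]
  show ?thesis
    by (rule pullback_lift[OF pb, of x W y]) (use x y eq that in simp_all)
qed

text \<open>Pullback stability for elements: every element of the codomain lifts locally, that is,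
  after restriction along a regular epimorphism.\<close>

lemma regular_epi_lift:
  assumes e: "regular_epi C e" "e \<in> hom C X Y" and w: "w \<in> hom C W Y"
  obtains W' c z where "c \<in> hom C W' W" "regular_epi C c" "z \<in> hom C W' X" "e \<cdot> z = w \<cdot> c"
proof -
  obtain z c where pb: "is_pullback C z c e w"
    using pullback_exists[OF fin_complete e(2) w] by blast
  then have "regular_epi C c"
    using exact e(1) unfolding exact_category_def regular_category_def by blast
  then show ?thesis
    using that[of c "Dom C z" z] pullbackD[OF pb] homD[OF e(2)] homD[OF w] by (simp add: hom_iff)
qed

text \<open>Clause (d) for elements. The comparison \<open>u\<close> with an actual pullback is only
  a regular epimorphism, so the element \<open>w\<close> of the pullback given by \<open>x\<close>
  and \<open>y\<close> lifts to \<open>E + E\<close> only locally.\<close>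

lemma regular_epi_coproduct_lift:
  assumes p: "p \<in> hom C E B" "regular_epi C p"
    and x: "x \<in> hom C W (B \<oplus> B)" and y: "y \<in> hom C W E"
    and eq: "copair C (Ident C B) (Ident C B) \<cdot> x = p \<cdot> y"
  obtains W' c z where "c \<in> hom C W' W" "regular_epi C c" "z \<in> hom C W' (E \<oplus> E)"
    "plus_arr C p p \<cdot> z = x \<cdot> c" "copair C (Ident C E) (Ident C E) \<cdot> z = y \<cdot> c"
proof -
  have fpb: "feeble_pullback C (plus_arr C p p) (copair C (Ident C E) (Ident C E))
          (copair C (Ident C B) (Ident C B)) p"
    using condP p unfolding condition_P_def by blast
  note [simp] = homD[OF p(1)] homD(1-3)[OF x] homD(1-3)[OF y]
  obtain t l where pb: "is_pullback C t l (copair C (Ident C B) (Ident C B)) p"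
    using pullback_exists[OF fin_complete, of "copair C (Ident C B) (Ident C B)" "B \<oplus> B" B p E] p
    by (auto simp: hom_iff)
  note [simp] = pullbackD(1-2,5)[OF pb]
  have [simp]: "Cod C t = B \<oplus> B" "Cod C l = E" using pullbackD[OF pb] by simp_all
  obtain u where u: "u \<in> hom C (E \<oplus> E) (Dom C t)" "t \<cdot> u = plus_arr C p p"
      "l \<cdot> u = copair C (Ident C E) (Ident C E)"
    by (rule pullback_lift[OF pb, of "plus_arr C p p" "E \<oplus> E" "copair C (Ident C E) (Ident C E)"])
      (auto simp: hom_iff)
  then have ru: "regular_epi C u"
    using fpb pb unfolding feeble_pullback_def by auto
  obtain w where w: "w \<in> hom C W (Dom C t)" "t \<cdot> w = x" "l \<cdot> w = y"
    by (rule pullback_lift[OF pb, of x W y]) (use x y eq in simp_all)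
  obtain W' c z where c: "c \<in> hom C W' W" "regular_epi C c" and z: "z \<in> hom C W' (E \<oplus> E)"
    and eqz: "u \<cdot> z = w \<cdot> c"
    by (rule regular_epi_lift[OF ru u(1) w(1)])
  note [simp] = homD[OF c(1)] homD(1-3)[OF z] homD(1-3)[OF u(1)] homD(1-3)[OF w(1)]
  have "plus_arr C p p \<cdot> z = t \<cdot> (u \<cdot> z)" by (rule comp_cong1[OF u(2), symmetric]) simp_all
  also have "\<dots> = x \<cdot> c" unfolding eqz by (rule comp_cong1[OF w(2)]) simp_all
  finally have 1: "plus_arr C p p \<cdot> z = x \<cdot> c" .
  have "copair C (Ident C E) (Ident C E) \<cdot> z = l \<cdot> (u \<cdot> z)" by (rule comp_cong1[OF u(3), symmetric]) simp_all
  also have "\<dots> = y \<cdot> c" unfolding eqz by (rule comp_cong1[OF w(3)]) simp_all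
  finally show ?thesis using that c z 1 by blast
qed

text \<open>Here \<open>e\<close> is the coequalizer of the kernel pair of \<open>f\<close>. If
  \<open>m\<close> identifies two elements, lift them locally along \<open>e\<close>: the lifts
  agree under \<open>f\<close>, so they form an element of the kernel pair and agree under
  \<open>e\<close>. Regular epimorphisms being epi, the two elements are equal.\<close>

lemma image_factorization:
  assumes f: "f \<in> hom C X Y"
  obtains I e m where "e \<in> hom C X I" "regular_epi C e" "m \<in> hom C I Y" "monic C m" "m \<cdot> e = f"
proof -
  obtain k1 k0 where kp: "is_pullback C k1 k0 f f"
    using pullback_exists[OF fin_complete f f] by blast
  then obtain e where co: "is_coequalizer C k0 k1 e"
    using exact unfolding exact_category_def regular_category_def is_kernel_pair_def by blast
  note [simp] = homD[OF f] pullbackD(1,2,5)[OF kp]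
  have [simp]: "Cod C k0 = X" "Cod C k1 = X" using pullbackD[OF kp] by simp_all
  obtain I where e: "e \<in> hom C X I" "regular_epi C e" "e \<cdot> k0 = e \<cdot> k1"
    using coequalizerD[OF co] co by (auto simp: hom_iff regular_epi_def)
  note [simp] = homD[OF e(1)]
  obtain m where m: "m \<in> hom C I Y" "m \<cdot> e = f"
    by (rule coequalizer_factor[OF co, of f Y]) (use pullbackD(9)[OF kp] f in auto)
  note [simp] = homD(1-3)[OF m(1)]
  have "monic C m"
    unfolding monic_def
  proof (intro conjI allI ballI impI)
    fix W a b assume "a \<in> hom C W (Dom C m)" "b \<in> hom C W (Dom C m)" and eq: "m \<cdot> a = m \<cdot> b"
    then have a: "a \<in> hom C W I" and b: "b \<in> hom C W I" by simp_all
    note [simp] = homD[OF a] homD[OF b]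
    obtain V c x where c: "c \<in> hom C V W" "regular_epi C c" and x: "x \<in> hom C V X" and ex: "e \<cdot> x = a \<cdot> c"
      by (rule regular_epi_lift[OF e(2,1) a])
    note [simp] = homD[OF c(1)] homD[OF x]
    obtain U d y where d: "d \<in> hom C U V" "regular_epi C d" and y: "y \<in> hom C U X" and ey: "e \<cdot> y = (b \<cdot> c) \<cdot> d"
      by (rule regular_epi_lift[OF e(2,1), of "b \<cdot> c" V]) (auto simp: hom_iff)
    note [simp] = homD[OF d(1)] homD[OF y]
    have ex': "e \<cdot> (x \<cdot> d) = a \<cdot> (c \<cdot> d)" by (rule comp_cong[OF ex]) simp_all
    have "f \<cdot> (x \<cdot> d) = m \<cdot> (e \<cdot> (x \<cdot> d))" by (rule comp_cong1[OF m(2), symmetric]) simp_all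
    also have "\<dots> = m \<cdot> (e \<cdot> y)"
      unfolding ex' ey using comp_cong[OF eq, of "c \<cdot> d"] by simp
    also have "\<dots> = f \<cdot> y" by (rule comp_cong1[OF m(2)]) simp_all
    finally have fxy: "f \<cdot> y = f \<cdot> (x \<cdot> d)" ..
    obtain z where z: "z \<in> hom C U (Dom C k1)" "k1 \<cdot> z = y" "k0 \<cdot> z = x \<cdot> d"
      by (rule pullback_lift[OF kp, of y U "x \<cdot> d"]) (use fxy in \<open>auto simp: hom_iff\<close>)
    have "e \<cdot> (k0 \<cdot> z) = e \<cdot> (k1 \<cdot> z)"
      by (rule comp_cong[OF e(3)]) (use homD[OF z(1)] in auto)
    then have "(a \<cdot> c) \<cdot> d = (b \<cdot> c) \<cdot> d" using z ex' ey by simp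
    then have "a \<cdot> c = b \<cdot> c"
      using regular_epi_epi[OF d(2), of "a \<cdot> c" I "b \<cdot> c"] by (simp add: hom_iff)
    then show "a = b"
      using regular_epi_epi[OF c(2), of a I b] by (simp add: hom_iff)
  qed simp
  then show ?thesis using that e m by blast
qed

end

section \<open>Extending a kernel pair along a split monomorphism\<close>

text \<open>If \<open>p\<close> is a regular epimorphism, the coequalizer of \<open>\<alpha> \<cdot> r1\<close> and \<open>\<alpha> \<cdot> r2\<close> is the pushout of \<open>p\<close> along \<open>\<alpha>\<close>.\<close>

locale split_mono_kernel_pair = exact_condition_P C for C :: "('o, 'm) cat" (structure) +
  fixes p r1 r2 \<alpha> \<beta> :: 'm and A B E R :: 'o
  assumes p: "p \<in> hom C B E"
    and kernel_pair: "is_pullback C r2 r1 p p" and R: "Dom C r2 = R"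
    and \<alpha>: "\<alpha> \<in> hom C B A" and \<beta>: "\<beta> \<in> hom C A B" and \<beta>\<alpha>: "\<beta> \<cdot> \<alpha> = Ident C B"
begin

text \<open>The pair \<open>(e1, e2)\<close> generates the relation on \<open>A\<close>: the summand
  \<open>A\<close> contributes the diagonal, the summand \<open>R\<close> the kernel pair of
  \<open>p\<close> transported along \<alpha>.\<close>

definition e1 :: 'm where "e1 = copair C (Ident C A) (\<alpha> \<cdot> r1)"
definition e2 :: 'm where "e2 = copair C (Ident C A) (\<alpha> \<cdot> r2)"

lemma r: "r1 \<in> hom C R B" "r2 \<in> hom C R B"
  using pullbackD[OF kernel_pair] R homD[OF p] by (auto simp: hom_iff)

lemmas typing [simp] = homD(1-3)[OF p] homD[OF \<alpha>] homD(1-3)[OF \<beta>] homD(1-4)[OF r(1)] homD(1-3)[OF r(2)]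

lemma \<beta>\<alpha>_comp [simp]: "x \<in> Arr C \<Longrightarrow> Cod C x = B \<Longrightarrow> \<beta> \<cdot> (\<alpha> \<cdot> x) = x"
  using comp_cong1[OF \<beta>\<alpha>, of x] by simp

lemma \<alpha>_monic: "monic C \<alpha>"
  unfolding monic_def
proof (intro conjI allI ballI impI)
  fix W f g assume f: "f \<in> hom C W (Dom C \<alpha>)" and g: "g \<in> hom C W (Dom C \<alpha>)" and eq: "\<alpha> \<cdot> f = \<alpha> \<cdot> g"
  have "\<beta> \<cdot> (\<alpha> \<cdot> f) = f" "\<beta> \<cdot> (\<alpha> \<cdot> g) = g" using homD[OF f] homD[OF g] by simp_all
  then show "f = g" unfolding eq by metis
qed simp

lemma refl_R: obtains s where "s \<in> hom C B R" "r1 \<cdot> s = Ident C B" "r2 \<cdot> s = Ident C B"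
  by (rule pullback_lift[OF kernel_pair, of "Ident C B" B "Ident C B"]) (use R in \<open>auto simp: hom_iff\<close>)

text \<open>The diagonal splits \<open>r2\<close>. This makes clause (d) available for
  \<open>r2\<close>, whether or not \<open>p\<close> is a regular epimorphism.\<close>

lemma regular_epi_r2: "regular_epi C r2"
proof -
  obtain s where "s \<in> hom C B R" "r2 \<cdot> s = Ident C B" using refl_R by blast
  then show ?thesis using split_epi_regular_epi[OF r(2)] by blast
qed

lemma e_hom: "e1 \<in> hom C (A \<oplus> R) A" "e2 \<in> hom C (A \<oplus> R) A"
  by (simp_all add: e1_def e2_def hom_iff)

lemma e_inj: "e1 \<cdot> inl C A R = Ident C A" "e2 \<cdot> inl C A R = Ident C A"
  "e1 \<cdot> inr C A R = \<alpha> \<cdot> r1" "e2 \<cdot> inr C A R = \<alpha> \<cdot> r2"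
  by (simp_all add: e1_def e2_def)

lemma regular_epi_e1: "regular_epi C e1"
  by (rule split_epi_regular_epi[OF e_hom(1), of "inl C A R"]) (simp_all add: hom_iff e1_def)

text \<open>Condition (c) forces the \<open>A\<close>-part of \<open>y\<close> into \<open>B\<close>, and condition (d) for \<open>r2\<close> then decomposes \<open>\<rho>\<close> so
  that its second part can be composed with the \<open>R\<close>-part of \<open>y\<close>.\<close>

lemma transitive_on_R:
  assumes y: "y \<in> hom C T (A \<oplus> R)" and \<rho>: "\<rho> \<in> hom C T R" and eq: "e1 \<cdot> y = \<alpha> \<cdot> (r2 \<cdot> \<rho>)"
  obtains T' c w where "c \<in> hom C T' T" "regular_epi C c" "w \<in> hom C T' R"
    "\<alpha> \<cdot> (r1 \<cdot> w) = \<alpha> \<cdot> (r1 \<cdot> (\<rho> \<cdot> c))" "\<alpha> \<cdot> (r2 \<cdot> w) = e2 \<cdot> (y \<cdot> c)"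
proof -
  note [simp] = homD(1-3)[OF y] homD[OF \<rho>]
  \<comment> \<open>Since \<open>e1\<close> is \<open>[1, \<alpha>]\<close> after
    \<open>1 + r1\<close>, the hypothesis is exactly what clause (c) for \<alpha> asks of
    \<open>(1 + r1) y\<close>.\<close>
  obtain v where v: "v \<in> hom C T (B \<oplus> B)" "plus_arr C \<alpha> (Ident C B) \<cdot> v = plus_arr C (Ident C A) r1 \<cdot> y"
      "copair C (Ident C B) (Ident C B) \<cdot> v = r2 \<cdot> \<rho>"
    by (rule mono_coproduct_lift[OF \<alpha> \<alpha>_monic, of "plus_arr C (Ident C A) r1 \<cdot> y" T "r2 \<cdot> \<rho>"])
      (use eq in \<open>simp_all add: hom_iff e1_def\<close>)
  \<comment> \<open>In \<open>v\<close> only \<open>r1\<close> of the \<open>R\<close>-part of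
    \<open>y\<close> is left; clause (b) restores that part itself.\<close>
  obtain y' where y': "y' \<in> hom C T (B \<oplus> R)" "plus_arr C \<alpha> (Ident C R) \<cdot> y' = y"
      "plus_arr C (Ident C B) r1 \<cdot> y' = v"
    by (rule coproduct_pullback_lift[OF pullback_ident_sides[OF \<alpha>] pullback_ident_rows[OF r(1)], of y T v])
      (use v y in simp_all)
  note [simp] = homD(1-3)[OF v(1)] homD(1-3)[OF y'(1)]
  obtain T' c g where c: "c \<in> hom C T' T" "regular_epi C c" and g: "g \<in> hom C T' (R \<oplus> R)"
      "plus_arr C r2 r2 \<cdot> g = v \<cdot> c" "copair C (Ident C R) (Ident C R) \<cdot> g = \<rho> \<cdot> c"
    by (rule regular_epi_coproduct_lift[OF r(2) regular_epi_r2, of v T \<rho>]) (use v \<rho> in auto)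
  note [simp] = homD[OF c(1)] homD(1-3)[OF g(1)]
  obtain \<pi>1 \<pi>2 where pb: "is_pullback C \<pi>1 \<pi>2 r2 r1"
    using pullback_exists[OF fin_complete r(2,1)] by blast
  note [simp] = pullbackD(1,2,5)[OF pb]
  have [simp]: "Cod C \<pi>1 = R" "Cod C \<pi>2 = R" using pullbackD[OF pb] by simp_all
  have [simp]: "Dom C \<pi>1 \<in> Obj C" by (simp add: Dom_Obj)
  have y'c: "plus_arr C (Ident C B) r1 \<cdot> (y' \<cdot> c) = v \<cdot> c" by (rule comp_cong1[OF y'(3)]) simp_all
  \<comment> \<open>On the first summand \<open>y'\<close> is \<open>r2\<close> of the part of
    \<open>g\<close>; on the second, the parts of \<open>g\<close> and \<open>y'\<close> are
    composable in \<open>R\<close>. So \<open>h\<close> lives in the coproduct of \<open>R\<close>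
    and the object of composable pairs.\<close>
  obtain h where h: "h \<in> hom C T' (R \<oplus> Dom C \<pi>1)" "plus_arr C (Ident C R) \<pi>1 \<cdot> h = g"
      "plus_arr C r2 \<pi>2 \<cdot> h = y' \<cdot> c"
    by (rule coproduct_pullback_lift[OF pullback_ident_rows[OF r(2)] pb, of g T' "y' \<cdot> c"])
      (use g y'c in \<open>simp_all add: hom_iff\<close>)
  note [simp] = homD(1-3)[OF h(1)]
  have "p \<cdot> (r2 \<cdot> \<pi>2) = p \<cdot> (r1 \<cdot> \<pi>2)" "p \<cdot> (r1 \<cdot> \<pi>1) = p \<cdot> (r2 \<cdot> \<pi>1)"
    using comp_cong[OF pullbackD(9)[OF kernel_pair]] by simp_all
  then obtain k where k: "k \<in> hom C (Dom C \<pi>1) R" "r2 \<cdot> k = r2 \<cdot> \<pi>2" "r1 \<cdot> k = r1 \<cdot> \<pi>1"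
    using pullback_lift[OF kernel_pair, of "r2 \<cdot> \<pi>2" "Dom C \<pi>1" "r1 \<cdot> \<pi>1"] pullbackD(9)[OF pb] R
    by (auto simp: hom_iff)
  note [simp] = homD(1-3)[OF k(1)]
  have "r1 \<cdot> (copair C (Ident C R) k \<cdot> h) = r1 \<cdot> (copair C (Ident C R) (Ident C R) \<cdot> (plus_arr C (Ident C R) \<pi>1 \<cdot> h))"
    using k by simp
  also have "\<dots> = r1 \<cdot> (\<rho> \<cdot> c)" using h g by simp
  finally have 1: "r1 \<cdot> (copair C (Ident C R) k \<cdot> h) = r1 \<cdot> (\<rho> \<cdot> c)" .
  have "\<alpha> \<cdot> (r2 \<cdot> (copair C (Ident C R) k \<cdot> h)) = \<alpha> \<cdot> (copair C (Ident C B) r2 \<cdot> (plus_arr C r2 \<pi>2 \<cdot> h))"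
    using k by simp
  also have "\<dots> = \<alpha> \<cdot> (copair C (Ident C B) r2 \<cdot> (y' \<cdot> c))"
    by (simp only: h)
  also have "\<dots> = e2 \<cdot> (plus_arr C \<alpha> (Ident C R) \<cdot> (y' \<cdot> c))"
    by (simp add: e2_def)
  also have "\<dots> = e2 \<cdot> (y \<cdot> c)"
    by (subst comp_cong1[OF y'(2)]) simp_all
  finally have 2: "\<alpha> \<cdot> (r2 \<cdot> (copair C (Ident C R) k \<cdot> h)) = e2 \<cdot> (y \<cdot> c)" .
  show ?thesis
    by (rule that[of c T' "copair C (Ident C R) k \<cdot> h"]) (use c 1 2 in \<open>simp_all add: hom_iff\<close>)
qed

text \<open>Condition (d) for \<open>e1\<close> splits \<open>w'\<close> along the two summands of \<open>w\<close>, which reduces transitivity to the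
  case of a \<open>w\<close> lying in \<open>R\<close>.\<close>

lemma transitive_cover:
  assumes jm: "jointly_monic d0 d1" and d0: "d0 \<in> hom C I A" and e: "e \<in> hom C (A \<oplus> R) I"
    and de: "d0 \<cdot> e = e1" "d1 \<cdot> e = e2"
    and w: "w \<in> hom C W (A \<oplus> R)" "w' \<in> hom C W (A \<oplus> R)" and eq: "e2 \<cdot> w = e1 \<cdot> w'"
  obtains V c x where "c \<in> hom C V W" "regular_epi C c" "x \<in> hom C V I"
    "d0 \<cdot> x = e1 \<cdot> (w \<cdot> c)" "d1 \<cdot> x = e2 \<cdot> (w' \<cdot> c)"
proof -
  have d1: "d1 \<in> hom C I A" using jm d0 by (auto simp: jointly_monic_def hom_iff)
  note [simp] = homD(1-3)[OF w(1)] homD(1-3)[OF w(2)] homD[OF d0] homD(1-3)[OF d1] homD(1-3)[OF e]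
    homD(1-3)[OF e_hom(1)] homD(1-3)[OF e_hom(2)]
  let ?w = "plus_arr C (Ident C A) (\<alpha> \<cdot> r2) \<cdot> w"
  \<comment> \<open>Since \<open>e2\<close> is the codiagonal after \<open>1 + \<alpha> r2\<close>,
    the hypothesis puts \<open>?w\<close> and \<open>w'\<close> over the same element of
    \<open>A\<close>, as clause (d) for \<open>e1\<close> requires.\<close>
  have "copair C (Ident C A) (Ident C A) \<cdot> ?w = e1 \<cdot> w'"
    using eq by (simp add: e2_def)
  then obtain V c y where c: "c \<in> hom C V W" "regular_epi C c"
      and y: "y \<in> hom C V ((A \<oplus> R) \<oplus> (A \<oplus> R))" "plus_arr C e1 e1 \<cdot> y = ?w \<cdot> c"
      "copair C (Ident C (A \<oplus> R)) (Ident C (A \<oplus> R)) \<cdot> y = w' \<cdot> c"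
    by (rule regular_epi_coproduct_lift[OF e_hom(1) regular_epi_e1, of ?w W w', rotated 2])
      (use w in \<open>simp_all add: hom_iff\<close>)
  note [simp] = homD[OF c(1)] homD(1-3)[OF y(1)]
  have "\<alpha> \<cdot> r2 \<in> hom C R A" by (simp add: hom_iff)
  \<comment> \<open>The universal case of an element \<rho> of \<open>R\<close> followed by an
    element \<open>z\<close> of \<open>A + R\<close>.\<close>
  then obtain z \<rho> where pb: "is_pullback C z \<rho> e1 (\<alpha> \<cdot> r2)"
    using pullback_exists[OF fin_complete e_hom(1)] by blast
  note [simp] = pullbackD(1,2,5)[OF pb]
  have [simp]: "Cod C z = A \<oplus> R" "Cod C \<rho> = R" "Dom C z \<in> Obj C"
    using pullbackD[OF pb] Dom_Obj[of z] by simp_all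
  \<comment> \<open>On the first summand the step \<open>w\<close> is an identity, so the composite
    is the part of \<open>y\<close> itself; on the second it is the universal composite, supplied by
    \<open>x\<close> below.\<close>
  obtain t where t: "t \<in> hom C V ((A \<oplus> R) \<oplus> Dom C z)"
      "plus_arr C (Ident C (A \<oplus> R)) z \<cdot> t = y" "plus_arr C e1 \<rho> \<cdot> t = w \<cdot> c"
    by (rule coproduct_pullback_lift[OF pullback_ident_rows[OF e_hom(1)] pb, of y V "w \<cdot> c"])
      (use y in \<open>simp_all add: hom_iff\<close>)
  note [simp] = homD(1-3)[OF t(1)]
  have "e1 \<cdot> z = \<alpha> \<cdot> (r2 \<cdot> \<rho>)" using pullbackD(9)[OF pb] by simp
  then obtain T' b u where b: "b \<in> hom C T' (Dom C z)" "regular_epi C b" and u: "u \<in> hom C T' R"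
      "\<alpha> \<cdot> (r1 \<cdot> u) = \<alpha> \<cdot> (r1 \<cdot> (\<rho> \<cdot> b))" "\<alpha> \<cdot> (r2 \<cdot> u) = e2 \<cdot> (z \<cdot> b)"
    by (rule transitive_on_R[of z "Dom C z" \<rho>, rotated 2]) (auto simp: hom_iff)
  note [simp] = homD[OF b(1)] homD(1-3)[OF u(1)]
  have "d0 \<cdot> (e \<cdot> (inr C A R \<cdot> u)) = e1 \<cdot> (inr C A R \<cdot> u)" "d1 \<cdot> (e \<cdot> (inr C A R \<cdot> u)) = e2 \<cdot> (inr C A R \<cdot> u)"
    using comp_cong1[OF de(1)] comp_cong1[OF de(2)] by simp_all
  moreover have "e1 \<cdot> (inr C A R \<cdot> u) = \<alpha> \<cdot> (r1 \<cdot> u)" "e2 \<cdot> (inr C A R \<cdot> u) = \<alpha> \<cdot> (r2 \<cdot> u)"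
    using comp_cong1[OF e_inj(3), of u] comp_cong1[OF e_inj(4), of u] by simp_all
  ultimately have "d0 \<cdot> (e \<cdot> (inr C A R \<cdot> u)) = (\<alpha> \<cdot> (r1 \<cdot> \<rho>)) \<cdot> b" "d1 \<cdot> (e \<cdot> (inr C A R \<cdot> u)) = (e2 \<cdot> z) \<cdot> b"
    using u by simp_all
  \<comment> \<open>\<open>transitive_on_R\<close> gives the composite only on the cover
    \<open>b\<close>. Joint monicity of \<open>d0\<close> and \<open>d1\<close> lets it descend to
    the whole domain of \<open>z\<close>, so that \<open>[e, x]\<close> can be formed.\<close>
  then obtain x where x: "x \<in> hom C (Dom C z) I" "d0 \<cdot> x = \<alpha> \<cdot> (r1 \<cdot> \<rho>)" "d1 \<cdot> x = e2 \<cdot> z"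
    by (rule cover_descent[OF regular_epi_cover[OF b(2)] b(1) jm d0, rotated 3])
      (auto simp: hom_iff)
  note [simp] = homD(1-3)[OF x(1)]
  have "d0 \<cdot> (copair C e x \<cdot> t) = copair C e1 (\<alpha> \<cdot> (r1 \<cdot> \<rho>)) \<cdot> t"
    using x de by simp
  also have "\<dots> = e1 \<cdot> (plus_arr C e1 \<rho> \<cdot> t)"
    by (simp add: e_inj comp_cong1[OF e_inj(1)] comp_cong1[OF e_inj(3)])
  also have "\<dots> = e1 \<cdot> (w \<cdot> c)" using t by simp
  finally have 1: "d0 \<cdot> (copair C e x \<cdot> t) = e1 \<cdot> (w \<cdot> c)" .
  have "d1 \<cdot> (copair C e x \<cdot> t) = copair C e2 (e2 \<cdot> z) \<cdot> t"
    using x de by simp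
  also have "\<dots> = e2 \<cdot> (copair C (Ident C (A \<oplus> R)) (Ident C (A \<oplus> R)) \<cdot> (plus_arr C (Ident C (A \<oplus> R)) z \<cdot> t))"
    by simp
  also have "\<dots> = e2 \<cdot> (w' \<cdot> c)" using t y by simp
  finally have 2: "d1 \<cdot> (copair C e x \<cdot> t) = e2 \<cdot> (w' \<cdot> c)" .
  show ?thesis
    by (rule that[of c V "copair C e x \<cdot> t"]) (use c 1 2 in \<open>simp_all add: hom_iff\<close>)
qed

section \<open>The equivalence relation on \<open>A\<close> and its quotient\<close>

lemma coequalizer_e_iff:
  assumes "h \<in> hom C A Z"
  shows "h \<cdot> e1 = h \<cdot> e2 \<longleftrightarrow> h \<cdot> (\<alpha> \<cdot> r1) = h \<cdot> (\<alpha> \<cdot> r2)"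
proof
  note [simp] = homD[OF assms] homD(1-3)[OF e_hom(1)] homD(1-3)[OF e_hom(2)]
  assume "h \<cdot> e1 = h \<cdot> e2"
  then have "h \<cdot> (e1 \<cdot> inr C A R) = h \<cdot> (e2 \<cdot> inr C A R)" by (rule comp_cong) simp_all
  then show "h \<cdot> (\<alpha> \<cdot> r1) = h \<cdot> (\<alpha> \<cdot> r2)" by (simp only: e_inj)
next
  assume "h \<cdot> (\<alpha> \<cdot> r1) = h \<cdot> (\<alpha> \<cdot> r2)"
  then show "h \<cdot> e1 = h \<cdot> e2" using homD[OF assms] by (simp add: e1_def e2_def)
qed

text \<open>The relation is the image of \<open>(e1, e2)\<close>. It is formed inside the kernel
  pair of \<open>p \<beta>\<close>, in place of a product of \<open>A\<close> with itself;
  \<open>e1\<close> and \<open>e2\<close> agree after \<open>p \<beta>\<close> because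
  \<open>p r1 = p r2\<close>.\<close>

lemma relation_exists:
  obtains I e d0 d1 where "e \<in> hom C (A \<oplus> R) I" "regular_epi C e" "d0 \<in> hom C I A" "jointly_monic d0 d1"
    "d0 \<cdot> e = e1" "d1 \<cdot> e = e2"
proof -
  have p\<beta>: "p \<cdot> \<beta> \<in> hom C A E" by (simp add: hom_iff)
  obtain k1 k0 where pb: "is_pullback C k1 k0 (p \<cdot> \<beta>) (p \<cdot> \<beta>)"
    using pullback_exists[OF fin_complete p\<beta> p\<beta>] by blast
  note [simp] = pullbackD(1,2,5)[OF pb]
  have [simp]: "Cod C k1 = A" "Cod C k0 = A" using pullbackD[OF pb] by simp_all
  have "p \<cdot> (\<beta> \<cdot> e1) = p \<cdot> (\<beta> \<cdot> e2)"
    using pullbackD(9)[OF kernel_pair] by (simp add: e1_def e2_def)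
  then obtain j where j: "j \<in> hom C (A \<oplus> R) (Dom C k1)" "k1 \<cdot> j = e2" "k0 \<cdot> j = e1"
    using pullback_lift[OF pb, of e2 "A \<oplus> R" e1] e_hom homD[OF e_hom(1)] homD[OF e_hom(2)] by auto
  obtain I e m where e: "e \<in> hom C (A \<oplus> R) I" "regular_epi C e" and m: "m \<in> hom C I (Dom C k1)" "monic C m"
    and me: "m \<cdot> e = j"
    by (rule image_factorization[OF j(1)])
  note [simp] = homD(1-3)[OF e(1)] homD(1-3)[OF m(1)]
  have "jointly_monic (k0 \<cdot> m) (k1 \<cdot> m)"
    unfolding jointly_monic_def
  proof (intro conjI allI ballI impI)
    fix W f g assume "f \<in> hom C W (Dom C (k0 \<cdot> m))" "g \<in> hom C W (Dom C (k0 \<cdot> m))"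
      and eq: "(k0 \<cdot> m) \<cdot> f = (k0 \<cdot> m) \<cdot> g \<and> (k1 \<cdot> m) \<cdot> f = (k1 \<cdot> m) \<cdot> g"
    then have f: "f \<in> hom C W I" and g: "g \<in> hom C W I" by simp_all
    note [simp] = homD[OF f] homD[OF g]
    have "m \<cdot> f = m \<cdot> g"
      by (rule pullback_ext[OF pb, of _ W]) (use eq in \<open>simp_all add: hom_iff\<close>)
    then show "f = g" using m(2) f g unfolding monic_def by auto
  qed (simp_all add: hom_iff)
  then show ?thesis
    using that[of e I "k0 \<cdot> m" "k1 \<cdot> m"] e me j by (simp add: hom_iff)
qed

text \<open>The image of \<open>(e1, e2)\<close> is an equivalence relation, hence by exactness the
  kernel pair of some arrow, and regularity gives its coequalizer \<open>q\<close>. The second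
  clause reads the kernel pair back: elements identified by \<open>q\<close> are related through
  \<open>A + R\<close> locally.\<close>

lemma quotient_exists:
  obtains q where "is_coequalizer C (\<alpha> \<cdot> r1) (\<alpha> \<cdot> r2) q"
    "\<And>W x y. x \<in> hom C W A \<Longrightarrow> y \<in> hom C W A \<Longrightarrow> q \<cdot> x = q \<cdot> y \<Longrightarrow>
      \<exists>V c w. c \<in> hom C V W \<and> regular_epi C c \<and> w \<in> hom C V (A \<oplus> R) \<and> e1 \<cdot> w = x \<cdot> c \<and> e2 \<cdot> w = y \<cdot> c"
proof -
  obtain I e d0 d1 where e: "e \<in> hom C (A \<oplus> R) I" "regular_epi C e" and d0: "d0 \<in> hom C I A"
    and jm: "jointly_monic d0 d1" and de: "d0 \<cdot> e = e1" "d1 \<cdot> e = e2"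
    by (rule relation_exists)
  have d1: "d1 \<in> hom C I A" using jm d0 by (auto simp: jointly_monic_def hom_iff)
  note [simp] = homD(1-3)[OF e(1)] homD[OF d0] homD(1-3)[OF d1] homD(1-3)[OF e_hom(1)] homD(1-3)[OF e_hom(2)]
  have de_comp: "d0 \<cdot> (e \<cdot> x) = e1 \<cdot> x" "d1 \<cdot> (e \<cdot> x) = e2 \<cdot> x" if "x \<in> Arr C" "Cod C x = A \<oplus> R" for x
    using that comp_cong1[OF de(1)] comp_cong1[OF de(2)] by simp_all
  have "internal_equivalence C d0 d1"
    unfolding internal_equivalence_def
  proof (intro conjI)
    show "\<forall>W. \<forall>f \<in> hom C W (Dom C d0). \<forall>g \<in> hom C W (Dom C d0).
        d0 \<cdot> f = d0 \<cdot> g \<and> d1 \<cdot> f = d1 \<cdot> g \<longrightarrow> f = g"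
      using jm by (simp add: jointly_monic_def)
    show "\<exists>s \<in> hom C (Cod C d0) (Dom C d0). d0 \<cdot> s = Ident C (Cod C d0) \<and> d1 \<cdot> s = Ident C (Cod C d0)"
      by (rule bexI[of _ "e \<cdot> inl C A R"]) (simp_all add: de_comp e_inj hom_iff)
    show "\<exists>t \<in> hom C (Dom C d0) (Dom C d0). d0 \<cdot> t = d1 \<and> d1 \<cdot> t = d0"
    proof -
      obtain \<sigma> where \<sigma>: "\<sigma> \<in> hom C R R" "r2 \<cdot> \<sigma> = r1" "r1 \<cdot> \<sigma> = r2"
        by (rule pullback_lift[OF kernel_pair, of r1 R r2])
          (use R pullbackD(9)[OF kernel_pair] in \<open>auto simp: hom_iff\<close>)
      note [simp] = homD(1-3)[OF \<sigma>(1)]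
      \<comment> \<open>The swap \<sigma> of the kernel pair exchanges \<open>e1\<close> and
        \<open>e2\<close>, and this symmetry descends along \<open>e\<close>.\<close>
      have "e1 \<cdot> plus_arr C (Ident C A) \<sigma> = e2" "e2 \<cdot> plus_arr C (Ident C A) \<sigma> = e1"
        using \<sigma> by (simp_all add: e1_def e2_def)
      then have "d0 \<cdot> (e \<cdot> plus_arr C (Ident C A) \<sigma>) = d1 \<cdot> e" "d1 \<cdot> (e \<cdot> plus_arr C (Ident C A) \<sigma>) = d0 \<cdot> e"
        using de de_comp[of "plus_arr C (Ident C A) \<sigma>"] by simp_all
      then obtain t where "t \<in> hom C I I" "d0 \<cdot> t = d1" "d1 \<cdot> t = d0"
        by (rule cover_descent[OF regular_epi_cover[OF e(2)] e(1) jm d0, rotated 3])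
          (auto simp: hom_iff)
      then show ?thesis by auto
    qed
    show "\<forall>p q. is_pullback C q p d0 d1 \<longrightarrow>
        (\<exists>c \<in> hom C (Dom C p) (Dom C d0). d0 \<cdot> c = d0 \<cdot> p \<and> d1 \<cdot> c = d1 \<cdot> q)"
    proof (intro allI impI)
      fix a b assume pb: "is_pullback C b a d0 d1"
      define W where "W = Dom C a"
      have a: "a \<in> hom C W I" and b: "b \<in> hom C W I" and ab: "d0 \<cdot> b = d1 \<cdot> a"
        using pullbackD[OF pb] by (simp_all add: hom_iff W_def)
      note [simp] = homD[OF a] homD(1-3)[OF b]
      obtain V1 c1 w where c1: "c1 \<in> hom C V1 W" "regular_epi C c1" and w: "w \<in> hom C V1 (A \<oplus> R)"
        and ew: "e \<cdot> w = a \<cdot> c1"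
        by (rule regular_epi_lift[OF e(2,1) a])
      note [simp] = homD[OF c1(1)] homD(1-3)[OF w]
      obtain V2 c2 w' where c2: "c2 \<in> hom C V2 V1" "regular_epi C c2" and w': "w' \<in> hom C V2 (A \<oplus> R)"
        and ew': "e \<cdot> w' = (b \<cdot> c1) \<cdot> c2"
        by (rule regular_epi_lift[OF e(2,1), of "b \<cdot> c1" V1]) (simp_all add: hom_iff)
      note [simp] = homD[OF c2(1)] homD(1-3)[OF w']
      have ewx: "e \<cdot> (w \<cdot> x) = a \<cdot> (c1 \<cdot> x)" if "x \<in> Arr C" "Cod C x = V1" for x
        using that by (intro comp_cong ew) simp_all
      have ewx': "e \<cdot> (w' \<cdot> x) = b \<cdot> (c1 \<cdot> (c2 \<cdot> x))" if "x \<in> Arr C" "Cod C x = V2" for x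
        using comp_cong[OF ew', of x] that by simp
      \<comment> \<open>\<open>w\<close> and \<open>w'\<close> are local lifts of \<open>a\<close>
        and \<open>b\<close> along \<open>e\<close>, and \<open>d0 b = d1 a\<close> becomes the
        hypothesis of \<open>transitive_cover\<close>.\<close>
      have "e2 \<cdot> (w \<cdot> c2) = d1 \<cdot> (a \<cdot> (c1 \<cdot> c2))"
        by (simp add: de_comp[symmetric] ewx)
      also have "\<dots> = d0 \<cdot> (b \<cdot> (c1 \<cdot> c2))"
        by (rule comp_cong[OF ab[symmetric]]) simp_all
      also have "\<dots> = e1 \<cdot> w'"
        using ew' by (simp add: de_comp[symmetric])
      finally obtain V3 c3 x where c3: "c3 \<in> hom C V3 V2" "regular_epi C c3" and x: "x \<in> hom C V3 I"
        "d0 \<cdot> x = e1 \<cdot> ((w \<cdot> c2) \<cdot> c3)" "d1 \<cdot> x = e2 \<cdot> (w' \<cdot> c3)"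
        by (rule transitive_cover[OF jm d0 e(1) de, rotated 2]) (simp_all add: hom_iff)
      note [simp] = homD[OF c3(1)] homD(1-3)[OF x(1)]
      have cov: "cover (c1 \<cdot> (c2 \<cdot> c3))"
        using c1 c2 c3 by (intro cover_comp regular_epi_cover) simp_all
      have "d0 \<cdot> x = (d0 \<cdot> a) \<cdot> (c1 \<cdot> (c2 \<cdot> c3))" "d1 \<cdot> x = (d1 \<cdot> b) \<cdot> (c1 \<cdot> (c2 \<cdot> c3))"
        unfolding x by (simp_all add: de_comp[symmetric] ewx ewx')
      \<comment> \<open>The composite \<open>x\<close> exists on an iterated cover of
        \<open>W\<close>; being an element of a jointly monic pair, it descends to
        \<open>W\<close>.\<close>
      then obtain c where "c \<in> hom C W I" "d0 \<cdot> c = d0 \<cdot> a" "d1 \<cdot> c = d1 \<cdot> b"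
        by (rule cover_descent[OF cov _ jm d0 x(1), rotated 3]) (simp_all add: hom_iff)
      then show "\<exists>c \<in> hom C (Dom C a) (Dom C d0). d0 \<cdot> c = d0 \<cdot> a \<and> d1 \<cdot> c = d1 \<cdot> b"
        by auto
    qed
  qed (simp_all add: hom_iff)
  then obtain f where f: "is_pullback C d1 d0 f f"
    using exact unfolding exact_category_def is_kernel_pair_def by blast
  then obtain q where q: "is_coequalizer C d0 d1 q"
    using exact unfolding exact_category_def regular_category_def is_kernel_pair_def by blast
  note [simp] = coequalizerD(5,6)[OF q] pullbackD(3)[OF f]
  have [simp]: "Dom C f = A" using pullbackD[OF f] by simp
  \<comment> \<open>As \<open>e\<close> is epi, an arrow coequalizes \<open>d0\<close> and
    \<open>d1\<close> iff it coequalizes \<open>e1\<close> and \<open>e2\<close>; so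
    \<open>q\<close> is a coequalizer of the original pair as well.\<close>
  have iff: "h \<cdot> d0 = h \<cdot> d1 \<longleftrightarrow> h \<cdot> (\<alpha> \<cdot> r1) = h \<cdot> (\<alpha> \<cdot> r2)" if h: "h \<in> hom C A Z" for h Z
  proof -
    note [simp] = homD[OF h]
    have "h \<cdot> d0 = h \<cdot> d1 \<longleftrightarrow> (h \<cdot> d0) \<cdot> e = (h \<cdot> d1) \<cdot> e"
      using regular_epi_epi[OF e(2), of "h \<cdot> d0" Z "h \<cdot> d1"] by (auto simp: hom_iff simp del: assoc)
    also have "\<dots> \<longleftrightarrow> h \<cdot> e1 = h \<cdot> e2" by (simp add: de)
    finally show ?thesis using coequalizer_e_iff[OF h] by simp
  qed
  have "is_coequalizer C (\<alpha> \<cdot> r1) (\<alpha> \<cdot> r2) q"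
    unfolding is_coequalizer_def
  proof (intro conjI allI ballI impI)
    show "q \<cdot> (\<alpha> \<cdot> r1) = q \<cdot> (\<alpha> \<cdot> r2)"
      using iff[of q "Cod C q"] coequalizerD[OF q] by (simp add: hom_iff)
    fix Z h assume "h \<in> hom C (Cod C (\<alpha> \<cdot> r1)) Z" "h \<cdot> (\<alpha> \<cdot> r1) = h \<cdot> (\<alpha> \<cdot> r2)"
    then have "h \<in> hom C (Cod C d0) Z" "h \<cdot> d0 = h \<cdot> d1" using iff by simp_all
    then show "\<exists>!k. k \<in> hom C (Cod C q) Z \<and> k \<cdot> q = h"
      using q unfolding is_coequalizer_def by blast
  qed (simp_all add: hom_iff)
  moreover
  have "\<exists>V c w. c \<in> hom C V W \<and> regular_epi C c \<and> w \<in> hom C V (A \<oplus> R) \<and> e1 \<cdot> w = x \<cdot> c \<and> e2 \<cdot> w = y \<cdot> c"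
    if x: "x \<in> hom C W A" and y: "y \<in> hom C W A" and eq: "q \<cdot> x = q \<cdot> y" for W x y
  proof -
    note [simp] = homD[OF x] homD(1-3)[OF y]
    \<comment> \<open>The arrow \<open>f\<close> factors through \<open>q\<close>, so elements
      identified by \<open>q\<close> are identified by \<open>f\<close> and lie in its kernel pair
      \<open>(d0, d1)\<close>.\<close>
    obtain k where k: "k \<in> hom C (Cod C q) (Cod C f)" "k \<cdot> q = f"
      by (rule coequalizer_factor[OF q, of f "Cod C f"])
        (use pullbackD(9)[OF f] in \<open>simp_all add: hom_iff\<close>)
    note [simp] = homD(1-2)[OF k(1)]
    have "k \<cdot> (q \<cdot> x) = f \<cdot> x" "k \<cdot> (q \<cdot> y) = f \<cdot> y"
      by (rule comp_cong1[OF k(2)]; simp)+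
    then have fxy: "f \<cdot> y = f \<cdot> x" using eq by simp
    obtain z where z: "z \<in> hom C W I" "d1 \<cdot> z = y" "d0 \<cdot> z = x"
      by (rule pullback_lift[OF f, of y W x]) (use fxy x y in simp_all)
    obtain V c w where c: "c \<in> hom C V W" "regular_epi C c" and w: "w \<in> hom C V (A \<oplus> R)"
      and ew: "e \<cdot> w = z \<cdot> c"
      by (rule regular_epi_lift[OF e(2,1) z(1)])
    note [simp] = homD(1-3)[OF z(1)] homD(1-3)[OF c(1)] homD(1-3)[OF w]
    have "d0 \<cdot> (z \<cdot> c) = x \<cdot> c" "d1 \<cdot> (z \<cdot> c) = y \<cdot> c"
      using comp_cong1[OF z(3), of c] comp_cong1[OF z(2), of c] by simp_all
    then have "e1 \<cdot> w = x \<cdot> c" "e2 \<cdot> w = y \<cdot> c"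
      using de_comp[of w] ew by simp_all
    then show ?thesis using c w by blast
  qed
  ultimately show ?thesis using that by blast
qed

text \<open>The coequalizer from \<open>quotient_exists\<close> factors through any other one, so
  its description of identified elements carries over.\<close>

lemma quotient_lift:
  assumes q: "is_coequalizer C (\<alpha> \<cdot> r1) (\<alpha> \<cdot> r2) q"
    and x: "x \<in> hom C W A" and y: "y \<in> hom C W A" and eq: "q \<cdot> x = q \<cdot> y"
  obtains V c w where "c \<in> hom C V W" "regular_epi C c" "w \<in> hom C V (A \<oplus> R)"
    "e1 \<cdot> w = x \<cdot> c" "e2 \<cdot> w = y \<cdot> c"
proof -
  obtain q0 where q0: "is_coequalizer C (\<alpha> \<cdot> r1) (\<alpha> \<cdot> r2) q0"
    and lift: "\<And>W x y. x \<in> hom C W A \<Longrightarrow> y \<in> hom C W A \<Longrightarrow> q0 \<cdot> x = q0 \<cdot> y \<Longrightarrow>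
      \<exists>V c w. c \<in> hom C V W \<and> regular_epi C c \<and> w \<in> hom C V (A \<oplus> R) \<and> e1 \<cdot> w = x \<cdot> c \<and> e2 \<cdot> w = y \<cdot> c"
    by (rule quotient_exists) blast
  note [simp] = homD[OF x] homD(1-3)[OF y] coequalizerD(5)[OF q] coequalizerD(5)[OF q0]
  have [simp]: "Dom C q = A" "Dom C q0 = A" using coequalizerD[OF q] coequalizerD[OF q0] by simp_all
  obtain k where k: "k \<in> hom C (Cod C q) (Cod C q0)" "k \<cdot> q = q0"
    by (rule coequalizer_factor[OF q, of q0 "Cod C q0"])
      (use coequalizerD(7)[OF q0] in \<open>simp_all add: hom_iff\<close>)
  note [simp] = homD(1-2)[OF k(1)]
  have "k \<cdot> (q \<cdot> x) = q0 \<cdot> x" "k \<cdot> (q \<cdot> y) = q0 \<cdot> y"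
    by (rule comp_cong1[OF k(2)]; simp)+
  then have "q0 \<cdot> x = q0 \<cdot> y" using eq by simp
  then show ?thesis using lift[OF x y] that by blast
qed

text \<open>This is the joint monicity of \<open>\<beta>\<close> and the quotient map: equality of the images under \<open>\<beta>\<close>
  puts the \<open>R\<close>-part of \<open>w\<close> on the diagonal.\<close>

lemma e_eq_if_\<beta>_eq:
  assumes w: "w \<in> hom C W (A \<oplus> R)" and eq: "\<beta> \<cdot> (e1 \<cdot> w) = \<beta> \<cdot> (e2 \<cdot> w)"
  shows "e1 \<cdot> w = e2 \<cdot> w"
proof -
  obtain s where s: "s \<in> hom C B R" "r1 \<cdot> s = Ident C B" "r2 \<cdot> s = Ident C B"
    by (rule refl_R)
  note [simp] = homD(1-3)[OF w] homD(1-3)[OF s(1)]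
  have rs [simp]: "r1 \<cdot> (s \<cdot> x) = x" "r2 \<cdot> (s \<cdot> x) = x" if "x \<in> Arr C" "Cod C x = B" for x
    using comp_cong1[OF s(2), of x] comp_cong1[OF s(3), of x] that by simp_all
  have "monic C s"
    unfolding monic_def
  proof (intro conjI allI ballI impI)
    fix V f g assume f: "f \<in> hom C V (Dom C s)" and g: "g \<in> hom C V (Dom C s)" and sfg: "s \<cdot> f = s \<cdot> g"
    have "r1 \<cdot> (s \<cdot> f) = f" "r1 \<cdot> (s \<cdot> g) = g" using homD[OF f] homD[OF g] by simp_all
    then show "f = g" unfolding sfg by metis
  qed simp
  \<comment> \<open>The summands are exchanged because clause (c) for \<open>s : B -> R\<close>
    wants \<open>R\<close> on the left.\<close>
  define w' where "w' = copair C (inr C R A) (inl C R A) \<cdot> w"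
  have w': "w' \<in> hom C W (R \<oplus> A)" by (simp add: w'_def hom_iff)
  note [simp] = homD(1-3)[OF w']
  have ew: "e1 \<cdot> w = copair C (\<alpha> \<cdot> r1) (Ident C A) \<cdot> w'" "e2 \<cdot> w = copair C (\<alpha> \<cdot> r2) (Ident C A) \<cdot> w'"
    by (simp_all add: w'_def e1_def e2_def)
  have eq': "copair C r1 \<beta> \<cdot> w' = copair C r2 \<beta> \<cdot> w'"
    using eq unfolding ew by simp
  let ?v = "plus_arr C (Ident C R) \<beta> \<cdot> w'"
  \<comment> \<open>The components of \<open>[1, s] ?v\<close> under \<open>r1\<close> and
    \<open>r2\<close> are \<open>[r1, \<beta>] w'\<close> and \<open>[r2, \<beta>] w'\<close>. By
    \<open>eq'\<close> they coincide, so this element of \<open>R\<close> lies on the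
    diagonal.\<close>
  have "copair C (Ident C R) s \<cdot> ?v = s \<cdot> (copair C r1 \<beta> \<cdot> w')"
    by (rule pullback_ext[OF kernel_pair, of _ W]) (use R eq' in \<open>simp_all add: hom_iff\<close>)
  then obtain z where z: "z \<in> hom C W (B \<oplus> B)" "plus_arr C s (Ident C B) \<cdot> z = ?v"
    by (rule mono_coproduct_lift[OF s(1) \<open>monic C s\<close>, rotated 2]) (simp_all add: hom_iff)
  obtain y where y: "y \<in> hom C W (B \<oplus> A)" "plus_arr C s (Ident C A) \<cdot> y = w'"
    by (rule coproduct_pullback_lift[OF pullback_ident_sides[OF s(1)] pullback_ident_rows[OF \<beta>], of w' W z])
      (use z w' in simp_all)
  note [simp] = homD(1-3)[OF y(1)]
  show ?thesis unfolding ew y(2)[symmetric] using s by simp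
qed

end

section \<open>Reflection of isomorphisms\<close>

context exact_condition_P
begin

lemma quotient_reflects_iso:
  assumes S: "split_mono_kernel_pair C p r1 r2 \<alpha> \<beta> A B E R"
    and S': "split_mono_kernel_pair C p r1 r2 \<alpha>' \<beta>' A' B E R"
    and f: "f \<in> hom C A A'" "f \<cdot> \<alpha> = \<alpha>'" "\<beta>' \<cdot> f = \<beta>"
    and q: "is_coequalizer C (\<alpha> \<cdot> r1) (\<alpha> \<cdot> r2) q" and q': "is_coequalizer C (\<alpha>' \<cdot> r1) (\<alpha>' \<cdot> r2) q'"
    and h: "h \<in> hom C (Cod C q) (Cod C q')" "h \<cdot> q = q' \<cdot> f" "iso C h"
  shows "iso C f"
proof -
  interpret S: split_mono_kernel_pair C p r1 r2 \<alpha> \<beta> A B E R by (rule S)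
  interpret S': split_mono_kernel_pair C p r1 r2 \<alpha>' \<beta>' A' B E R by (rule S')
  note [simp] = homD(1-3)[OF f(1)] homD(1-3)[OF S.e_hom(1)] homD(1-3)[OF S.e_hom(2)]
    homD(1-3)[OF S'.e_hom(1)] homD(1-3)[OF S'.e_hom(2)] coequalizerD(5)[OF q] coequalizerD(5)[OF q'] homD(1-3)[OF h(1)]
  have [simp]: "Dom C q = A" "Dom C q' = A'" using coequalizerD[OF q] coequalizerD[OF q'] by simp_all
  obtain g where g: "g \<in> hom C (Cod C q') (Cod C q)" "g \<cdot> h = Ident C (Cod C q)" "h \<cdot> g = Ident C (Cod C q')"
    using h(3) unfolding iso_def by auto
  note [simp] = homD(1-3)[OF g(1)]
  \<comment> \<open>Elements identified by \<open>f\<close> agree under \<open>q\<close>, as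
    \<open>h\<close> is invertible, and under \<beta>, as \<beta> factors through
    \<open>f\<close>.\<close>
  have f_monic: "monic C f"
    unfolding monic_def
  proof (intro conjI allI ballI impI)
    fix W x y assume "x \<in> hom C W (Dom C f)" "y \<in> hom C W (Dom C f)" and eq: "f \<cdot> x = f \<cdot> y"
    then have x: "x \<in> hom C W A" and y: "y \<in> hom C W A" by simp_all
    note [simp] = homD[OF x] homD(1-3)[OF y]
    have hq: "h \<cdot> (q \<cdot> x) = q' \<cdot> (f \<cdot> x)" "h \<cdot> (q \<cdot> y) = q' \<cdot> (f \<cdot> y)"
      by (rule comp_cong[OF h(2)]; simp)+
    have gh: "g \<cdot> (h \<cdot> (q \<cdot> x)) = q \<cdot> x" "g \<cdot> (h \<cdot> (q \<cdot> y)) = q \<cdot> y"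
      using comp_cong1[OF g(2), of "q \<cdot> x"] comp_cong1[OF g(2), of "q \<cdot> y"] by simp_all
    have qxy: "q \<cdot> x = q \<cdot> y"
      using gh hq eq by metis
    have "\<beta>' \<cdot> (f \<cdot> x) = \<beta> \<cdot> x" "\<beta>' \<cdot> (f \<cdot> y) = \<beta> \<cdot> y"
      by (rule comp_cong1[OF f(3)]; simp)+
    then have \<beta>xy: "\<beta> \<cdot> x = \<beta> \<cdot> y" using eq by metis
    obtain V c w where c: "c \<in> hom C V W" "regular_epi C c" and w: "w \<in> hom C V (A \<oplus> R)"
        "S.e1 \<cdot> w = x \<cdot> c" "S.e2 \<cdot> w = y \<cdot> c"
      by (rule S.quotient_lift[OF q x y qxy])
    note [simp] = homD(1-3)[OF c(1)]
    have "\<beta> \<cdot> (x \<cdot> c) = \<beta> \<cdot> (y \<cdot> c)" by (rule comp_cong[OF \<beta>xy]) simp_all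
    then have "x \<cdot> c = y \<cdot> c" using S.e_eq_if_\<beta>_eq[OF w(1)] w by simp
    then show "x = y" using regular_epi_epi[OF c(2), of x A y] x y by simp
  qed simp
  have q_hom: "q \<in> hom C A (Cod C q)" "regular_epi C q" using q by (auto simp: hom_iff regular_epi_def)
  \<comment> \<open>\<open>a\<close> is locally a preimage of the class of \<open>c\<close> under
    the isomorphism \<open>h\<close>, so \<open>f a\<close> and \<open>c\<close> are identified by
    \<open>q'\<close>.\<close>
  obtain V c a where c: "c \<in> hom C V A'" "regular_epi C c" and a: "a \<in> hom C V A"
      and qa: "q \<cdot> a = (g \<cdot> q') \<cdot> c"
    by (rule regular_epi_lift[OF q_hom(2,1), of "g \<cdot> q'" A']) (simp_all add: hom_iff)
  note [simp] = homD[OF c(1)] homD(1-3)[OF a]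
  have "q' \<cdot> (f \<cdot> a) = h \<cdot> (q \<cdot> a)" by (rule comp_cong[OF h(2)[symmetric]]) simp_all
  also have "\<dots> = h \<cdot> (g \<cdot> (q' \<cdot> c))" using qa by simp
  also have "\<dots> = q' \<cdot> c" using comp_cong1[OF g(3), of "q' \<cdot> c"] by simp
  finally have "q' \<cdot> c = q' \<cdot> (f \<cdot> a)" ..
  then obtain U d w where d: "d \<in> hom C U V" "regular_epi C d" and w: "w \<in> hom C U (A' \<oplus> R)"
      "S'.e1 \<cdot> w = c \<cdot> d" "S'.e2 \<cdot> w = (f \<cdot> a) \<cdot> d"
    by (rule S'.quotient_lift[OF q', rotated 2]) (simp_all add: hom_iff)
  note [simp] = homD[OF d(1)] homD(1-3)[OF w(1)]
  have f\<alpha>: "f \<cdot> (\<alpha> \<cdot> x) = \<alpha>' \<cdot> x" if "x \<in> Arr C" "Cod C x = B" for x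
    using comp_cong1[OF f(2), of x] that by simp
  \<comment> \<open>\<open>S'.e2\<close> is \<open>[1, f]\<close> after
    \<open>1 + \<alpha> r2\<close>, and its value at \<open>w\<close> lies in the image of
    \<open>f\<close>; clause (c) for \<open>f\<close> applies. Clause (b) then lifts
    \<open>w\<close> itself to \<open>y\<close> in \<open>A + R\<close>.\<close>
  obtain z where z: "z \<in> hom C U (A \<oplus> A)" "plus_arr C f (Ident C A) \<cdot> z = plus_arr C (Ident C A') (\<alpha> \<cdot> r2) \<cdot> w"
    by (rule mono_coproduct_lift[OF f(1) f_monic, of "plus_arr C (Ident C A') (\<alpha> \<cdot> r2) \<cdot> w" U "a \<cdot> d"])
      (use w(3) f\<alpha> in \<open>simp_all add: hom_iff S'.e2_def\<close>)
  have \<alpha>r2: "\<alpha> \<cdot> r2 \<in> hom C R A" by (simp add: hom_iff)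
  obtain y where y: "y \<in> hom C U (A \<oplus> R)" "plus_arr C f (Ident C R) \<cdot> y = w"
    by (rule coproduct_pullback_lift[OF pullback_ident_sides[OF f(1)] pullback_ident_rows[OF \<alpha>r2], of w U z])
      (use z w in simp_all)
  note [simp] = homD(1-3)[OF y(1)]
  have "f \<cdot> (S.e1 \<cdot> y) = Ident C A' \<cdot> (c \<cdot> d)"
    unfolding w(2)[symmetric] y(2)[symmetric] by (simp add: S.e1_def S'.e1_def f\<alpha>)
  moreover have "cover (c \<cdot> d)" using c d by (intro cover_comp regular_epi_cover) simp_all
  \<comment> \<open>The cover \<open>c d\<close> of \<open>A'\<close> factors through
    \<open>f\<close>. Descent for the pair \<open>(f, f)\<close> makes the identity of
    \<open>A'\<close> factor through \<open>f\<close>.\<close>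
  moreover have "jointly_monic f f"
    using f_monic by (auto simp: jointly_monic_def monic_def hom_iff)
  ultimately obtain k where k: "k \<in> hom C A' A" "f \<cdot> k = Ident C A'"
    using cover_descent[of "c \<cdot> d" U A' f f A A' "S.e1 \<cdot> y" "Ident C A'" "Ident C A'"]
    by (auto simp: hom_iff)
  note [simp] = homD(1-3)[OF k(1)]
  have "f \<cdot> (k \<cdot> f) = f \<cdot> Ident C A" using comp_cong1[OF k(2), of f] by simp
  moreover have "k \<cdot> f \<in> hom C A A" "Ident C A \<in> hom C A A" by (simp_all add: hom_iff)
  ultimately have "k \<cdot> f = Ident C A"
    using f_monic by (simp add: monic_def)
  then show ?thesis unfolding iso_def using k by auto
qed

text \<open>The square exhibiting \<open>0 + f\<close> as the pullback of \<open>E + f\<close> is the coproduct of two trivial pullbacks.\<close>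

lemma iso_if_iso_plus:
  assumes f: "f \<in> hom C A A'" and E: "E \<in> Obj C" and iso: "iso C (plus_arr C (Ident C E) f)"
  shows "iso C f"
proof -
  \<comment> \<open>\<open>Z\<close> is initial, as a coproduct of the empty family.\<close>
  obtain Z \<iota> where "is_coproduct C ({} :: nat set) (\<lambda>_. E) Z \<iota>"
    using condP unfolding condition_P_def has_finite_coproducts_def by (metis finite.emptyI image_empty empty_subsetI)
  then have Z: "Z \<in> Obj C" "\<And>X. X \<in> Obj C \<Longrightarrow> \<exists>!u. u \<in> hom C Z X"
    by (auto simp: is_coproduct_def)
  note [simp] = homD[OF f] E Z(1)
  obtain u v w where u: "u \<in> hom C Z E" and v: "v \<in> hom C Z A" and w: "w \<in> hom C Z A'"
    using Z(2) E homD(4,5)[OF f] by metis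
  note [simp] = homD(1-3)[OF u] homD(1-3)[OF v] homD(1-3)[OF w]
  have [simp]: "f \<cdot> v = w" using Z(2)[of A'] w by (metis Comp_hom f homD(5) v)
  have pb: "is_pullback C (plus_arr C u (Ident C A)) (plus_arr C (Ident C Z) f)
      (plus_arr C (Ident C E) f) (plus_arr C u (Ident C A'))"
    using pullback_ident_sides[OF u] pullback_ident_rows[OF f] condP unfolding condition_P_def by blast
  obtain g where g: "g \<in> hom C (E \<oplus> A') (E \<oplus> A)" "g \<cdot> plus_arr C (Ident C E) f = Ident C (E \<oplus> A)"
      "plus_arr C (Ident C E) f \<cdot> g = Ident C (E \<oplus> A')"
    using iso unfolding iso_def by auto
  note [simp] = homD(1-3)[OF g(1)]
  have "plus_arr C (Ident C E) f \<cdot> (g \<cdot> inr C E A') = inr C E A'"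
    using comp_cong1[OF g(3), of "inr C E A'"] by simp
  \<comment> \<open>\<open>k\<close> is the inverse of \<open>0 + f\<close> restricted to
    \<open>A'\<close>; following it by \<open>[v, 1] : 0 + A -> A\<close> will give the inverse of
    \<open>f\<close>.\<close>
  then obtain k where k: "k \<in> hom C A' (Z \<oplus> A)" "plus_arr C u (Ident C A) \<cdot> k = g \<cdot> inr C E A'"
      "plus_arr C (Ident C Z) f \<cdot> k = inr C Z A'"
    using pullback_lift[OF pb, of "g \<cdot> inr C E A'" A' "inr C Z A'"] by (auto simp: hom_iff)
  note [simp] = homD(1-3)[OF k(1)]
  let ?k = "copair C v (Ident C A) \<cdot> k"
  have "f \<cdot> ?k = copair C w (Ident C A') \<cdot> (plus_arr C (Ident C Z) f \<cdot> k)" by simp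
  also have "\<dots> = Ident C A'" unfolding k by simp
  finally have fk: "f \<cdot> ?k = Ident C A'" .
  have "k \<cdot> f = inr C Z A"
  proof (rule pullback_ext[OF pb, of _ A])
    have "plus_arr C u (Ident C A) \<cdot> (k \<cdot> f) = g \<cdot> (inr C E A' \<cdot> f)"
      using comp_cong[OF k(2), of f] by simp
    also have "\<dots> = g \<cdot> (plus_arr C (Ident C E) f \<cdot> inr C E A)" by simp
    also have "\<dots> = inr C E A"
      using comp_cong1[OF g(2), of "inr C E A"] by simp
    finally show "plus_arr C u (Ident C A) \<cdot> (k \<cdot> f) = plus_arr C u (Ident C A) \<cdot> inr C Z A" by simp
    show "plus_arr C (Ident C Z) f \<cdot> (k \<cdot> f) = plus_arr C (Ident C Z) f \<cdot> inr C Z A"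
      using comp_cong1[OF k(3), of f] by simp
  qed (simp_all add: hom_iff)
  then have "?k \<cdot> f = Ident C A" by simp
  then show ?thesis
    unfolding iso_def using fk by (auto simp: hom_iff intro!: bexI[of _ ?k])
qed

end

section \<open>Pushouts of split monomorphisms\<close>

lemma opp_simps [simp]:
  "Obj (opp C) = Obj C" "Arr (opp C) = Arr C" "Dom (opp C) = Cod C" "Cod (opp C) = Dom C"
  "Ident (opp C) = Ident C" "g \<cdot>\<^bsub>opp C\<^esub> f = f \<cdot>\<^bsub>C\<^esub> g"
  by (simp_all add: opp_def)

lemma hom_opp [simp]: "hom (opp C) A B = hom C B A"
  by (auto simp: hom_def)

lemma category_opp: "category C \<Longrightarrow> category (opp C)"
  by (rule category.intro)
    (auto simp: category.Dom_Obj category.Cod_Obj category.Id_hom category.Comp_hom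
      category.Comp_Id_right category.Comp_Id_left category.Comp_assoc)

lemma iso_opp: "iso (opp C) f \<longleftrightarrow> iso C f"
  by (auto simp: iso_def)

text \<open>These are pushouts in \<open>C\<close>: \<open>j\<close> and \<open>i\<close> are the
  coprojections out of the codomains of \<alpha> and \<open>p\<close>.\<close>

lemma is_pullback_opp:
  "is_pullback (opp C) j i \<alpha> p \<longleftrightarrow> {j, i, \<alpha>, p} \<subseteq> Arr C \<and> Cod C j = Cod C i \<and> Dom C j = Cod C \<alpha> \<and>
     Dom C i = Cod C p \<and> Dom C \<alpha> = Dom C p \<and> j \<cdot>\<^bsub>C\<^esub> \<alpha> = i \<cdot>\<^bsub>C\<^esub> p \<and>
     (\<forall>Z. \<forall>y \<in> hom C (Cod C \<alpha>) Z. \<forall>x \<in> hom C (Cod C p) Z. y \<cdot>\<^bsub>C\<^esub> \<alpha> = x \<cdot>\<^bsub>C\<^esub> p \<longrightarrow>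
       (\<exists>!h. h \<in> hom C (Cod C j) Z \<and> h \<cdot>\<^bsub>C\<^esub> j = y \<and> h \<cdot>\<^bsub>C\<^esub> i = x))"
proof (cases "comm_square (opp C) j i \<alpha> p")
  case True
  then have sq: "comm_square (opp C) y x \<alpha> p \<longleftrightarrow>
      y \<in> hom C (Cod C \<alpha>) (Cod C y) \<and> x \<in> hom C (Cod C p) (Cod C y) \<and> y \<cdot>\<^bsub>C\<^esub> \<alpha> = x \<cdot>\<^bsub>C\<^esub> p" for y x
    by (auto simp: comm_square_def hom_def)
  let ?U = "\<lambda>Z y x. \<exists>!h. h \<in> hom C (Cod C j) Z \<and> h \<cdot>\<^bsub>C\<^esub> j = y \<and> h \<cdot>\<^bsub>C\<^esub> i = x"
  have "is_pullback (opp C) j i \<alpha> p \<longleftrightarrow> (\<forall>y x. y \<in> hom C (Cod C \<alpha>) (Cod C y) \<and>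
      x \<in> hom C (Cod C p) (Cod C y) \<and> y \<cdot>\<^bsub>C\<^esub> \<alpha> = x \<cdot>\<^bsub>C\<^esub> p \<longrightarrow> ?U (Cod C y) y x)"
    unfolding is_pullback_def by (simp add: True) (simp add: sq)
  also have "\<dots> \<longleftrightarrow> (\<forall>Z. \<forall>y \<in> hom C (Cod C \<alpha>) Z. \<forall>x \<in> hom C (Cod C p) Z. y \<cdot>\<^bsub>C\<^esub> \<alpha> = x \<cdot>\<^bsub>C\<^esub> p \<longrightarrow> ?U Z y x)"
    (is "?L \<longleftrightarrow> ?R")
  proof
    assume L: ?L
    show ?R
    proof (intro allI ballI impI)
      fix Z y x assume *: "y \<in> hom C (Cod C \<alpha>) Z" "x \<in> hom C (Cod C p) Z" "y \<cdot>\<^bsub>C\<^esub> \<alpha> = x \<cdot>\<^bsub>C\<^esub> p"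
      then have "Cod C y = Z" by (simp add: hom_def)
      then show "?U Z y x" using L * by blast
    qed
  qed blast
  finally have "is_pullback (opp C) j i \<alpha> p \<longleftrightarrow> (\<forall>Z. \<forall>y \<in> hom C (Cod C \<alpha>) Z. \<forall>x \<in> hom C (Cod C p) Z.
      y \<cdot>\<^bsub>C\<^esub> \<alpha> = x \<cdot>\<^bsub>C\<^esub> p \<longrightarrow> ?U Z y x)" .
  moreover have "{j, i, \<alpha>, p} \<subseteq> Arr C" "Cod C j = Cod C i" "Dom C j = Cod C \<alpha>"
     "Dom C i = Cod C p" "Dom C \<alpha> = Dom C p" "j \<cdot>\<^bsub>C\<^esub> \<alpha> = i \<cdot>\<^bsub>C\<^esub> p"
    using True by (auto simp: comm_square_def)
  ultimately show ?thesis by blast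
next
  case False
  then show ?thesis by (auto simp: is_pullback_def comm_square_def)
qed

text \<open>The pushout of \<open>\<alpha>\<close> along an arbitrary \<open>p : B \<rightarrow> E\<close> is the pushout of \<open>1 + \<alpha> : E + B \<rightarrow> E + A\<close> along
  the split epimorphism \<open>[1, p] : E + B \<rightarrow> E\<close>.\<close>

locale pushout_reduction = exact_condition_P C for C :: "('o, 'm) cat" (structure) +
  fixes p r1 r2 \<alpha> \<beta> :: 'm and A B E R :: 'o
  assumes p: "p \<in> hom C B E"
    and \<alpha>: "\<alpha> \<in> hom C B A" and \<beta>: "\<beta> \<in> hom C A B" and \<beta>\<alpha>: "\<beta> \<cdot> \<alpha> = Ident C B"
    and kernel_pair: "is_pullback C r2 r1 (copair C (Ident C E) p) (copair C (Ident C E) p)"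
    and R: "Dom C r2 = R"
begin

abbreviation "p' \<equiv> copair C (Ident C E) p"
abbreviation "\<alpha>' \<equiv> plus_arr C (Ident C E) \<alpha>"
abbreviation "\<beta>' \<equiv> plus_arr C (Ident C E) \<beta>"

lemmas typing [simp] = homD[OF p] homD[OF \<alpha>] homD(1-3)[OF \<beta>]

lemma p': "p' \<in> hom C (E \<oplus> B) E" "regular_epi C p'"
proof -
  show *: "p' \<in> hom C (E \<oplus> B) E" by (simp add: hom_iff)
  show "regular_epi C p'"
    by (rule split_epi_regular_epi[OF *, of "inl C E B"]) (simp_all add: hom_iff)
qed

lemma split_mono_kernel_pair:
  "split_mono_kernel_pair C p' r1 r2 \<alpha>' \<beta>' (E \<oplus> A) (E \<oplus> B) E R"
  by unfold_locales (use p' kernel_pair R \<beta>\<alpha> in \<open>simp_all add: hom_iff\<close>)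

sublocale S: split_mono_kernel_pair C p' r1 r2 \<alpha>' \<beta>' "E \<oplus> A" "E \<oplus> B" E R
  by (rule split_mono_kernel_pair)

text \<open>As \<open>p'\<close> is the coequalizer of its kernel pair, the left side says that
  \<open>h \<alpha>'\<close> factors through \<open>p'\<close>. Restriction along \<open>inl\<close>
  forces the factor to be \<open>h inl\<close>, and restriction along \<open>inr\<close> is then the
  pushout condition.\<close>

lemma coequalizing_iff:
  assumes h: "h \<in> hom C (E \<oplus> A) Z"
  shows "h \<cdot> (\<alpha>' \<cdot> r1) = h \<cdot> (\<alpha>' \<cdot> r2) \<longleftrightarrow> h \<cdot> (inr C E A \<cdot> \<alpha>) = h \<cdot> (inl C E A \<cdot> p)"
proof
  note [simp] = homD[OF h]
  note r = homD(1-3)[OF S.r(1)] homD(1-3)[OF S.r(2)]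
  {
    assume eq: "h \<cdot> (\<alpha>' \<cdot> r1) = h \<cdot> (\<alpha>' \<cdot> r2)"
    have "h \<cdot> \<alpha>' \<in> hom C (Cod C r1) Z" using r by (simp add: hom_iff)
    moreover have "(h \<cdot> \<alpha>') \<cdot> r1 = (h \<cdot> \<alpha>') \<cdot> r2" using eq r by simp
    ultimately obtain k where k: "k \<in> hom C (Cod C p') Z" "k \<cdot> p' = h \<cdot> \<alpha>'"
      by (rule coequalizer_factor[OF regular_epi_coequalizer_kernel_pair[OF p'(2) kernel_pair]])
    then have [simp]: "k \<in> Arr C" "Dom C k = E" "Cod C k = Z" by (simp_all add: hom_iff)
    have kh: "k \<cdot> (p' \<cdot> x) = h \<cdot> (\<alpha>' \<cdot> x)" if "x \<in> Arr C" "Cod C x = E \<oplus> B" for x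
      by (rule comp_cong[OF k(2)]) (use that in simp_all)
    have "k = h \<cdot> inl C E A" "k \<cdot> p = h \<cdot> (inr C E A \<cdot> \<alpha>)"
      using kh[of "inl C E B"] kh[of "inr C E B"] by simp_all
    then show "h \<cdot> (inr C E A \<cdot> \<alpha>) = h \<cdot> (inl C E A \<cdot> p)" by simp
  next
    assume eq: "h \<cdot> (inr C E A \<cdot> \<alpha>) = h \<cdot> (inl C E A \<cdot> p)"
    have "h \<cdot> \<alpha>' = (h \<cdot> inl C E A) \<cdot> p'" using eq by simp
    then have "h \<cdot> (\<alpha>' \<cdot> x) = (h \<cdot> inl C E A) \<cdot> (p' \<cdot> x)" if "x \<in> Arr C" "Cod C x = E \<oplus> B" for x
      by (rule comp_cong) (use that in simp_all)
    then show "h \<cdot> (\<alpha>' \<cdot> r1) = h \<cdot> (\<alpha>' \<cdot> r2)"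
      using pullbackD(9)[OF kernel_pair] r by metis
  }
qed

lemma comp_eq_iff:
  assumes "q \<in> hom C (E \<oplus> A) P" "t \<in> hom C P Z" "h \<in> hom C (E \<oplus> A) Z"
  shows "t \<cdot> q = h \<longleftrightarrow> t \<cdot> (q \<cdot> inr C E A) = h \<cdot> inr C E A \<and> t \<cdot> (q \<cdot> inl C E A) = h \<cdot> inl C E A"
proof -
  note [simp] = homD(1-3)[OF assms(1)] homD(1-3)[OF assms(2)] homD(1-3)[OF assms(3)]
  show ?thesis
  proof
    assume "t \<cdot> q = h"
    then show "t \<cdot> (q \<cdot> inr C E A) = h \<cdot> inr C E A \<and> t \<cdot> (q \<cdot> inl C E A) = h \<cdot> inl C E A"
      using comp_cong1[of t q h] by simp
  next
    assume "t \<cdot> (q \<cdot> inr C E A) = h \<cdot> inr C E A \<and> t \<cdot> (q \<cdot> inl C E A) = h \<cdot> inl C E A"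
    then show "t \<cdot> q = h"
      using copair_ext[of "t \<cdot> q" E A Z h] assms by (simp add: hom_iff)
  qed
qed

text \<open>By \<open>coequalizing_iff\<close>, arrows out of \<open>E + A\<close> coequalizing the
  pair are the same as cocones under \<alpha> and \<open>p\<close>; hence the two universal
  properties translate into each other.\<close>

lemma coequalizer_if_pushout:
  assumes po: "is_pullback (opp C) j i \<alpha> p"
  shows "is_coequalizer C (\<alpha>' \<cdot> r1) (\<alpha>' \<cdot> r2) (copair C i j)"
proof -
  have [simp]: "j \<in> Arr C" "i \<in> Arr C" "Cod C j = Cod C i" "Dom C j = A" "Dom C i = E" "j \<cdot> \<alpha> = i \<cdot> p"
    using po by (simp_all add: is_pullback_opp)
  note r = homD(1-3)[OF S.r(1)] homD(1-3)[OF S.r(2)]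
  have q: "copair C i j \<in> hom C (E \<oplus> A) (Cod C i)" by (simp add: hom_iff)
  show ?thesis
    unfolding is_coequalizer_def
  proof (intro conjI allI ballI impI)
    show "copair C i j \<cdot> (\<alpha>' \<cdot> r1) = copair C i j \<cdot> (\<alpha>' \<cdot> r2)"
      using coequalizing_iff[OF q] by simp
    fix Z h assume "h \<in> hom C (Cod C (\<alpha>' \<cdot> r1)) Z" and eq: "h \<cdot> (\<alpha>' \<cdot> r1) = h \<cdot> (\<alpha>' \<cdot> r2)"
    then have h: "h \<in> hom C (E \<oplus> A) Z" using r by simp
    note [simp] = homD[OF h]
    have "(h \<cdot> inr C E A) \<cdot> \<alpha> = (h \<cdot> inl C E A) \<cdot> p" using coequalizing_iff[OF h] eq by simp
    moreover have "h \<cdot> inr C E A \<in> hom C (Cod C \<alpha>) Z" "h \<cdot> inl C E A \<in> hom C (Cod C p) Z"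
      by (simp_all add: hom_iff)
    ultimately have "\<exists>!t. t \<in> hom C (Cod C j) Z \<and> t \<cdot> j = h \<cdot> inr C E A \<and> t \<cdot> i = h \<cdot> inl C E A"
      using po unfolding is_pullback_opp by blast
    moreover have "t \<in> hom C (Cod C j) Z \<and> t \<cdot> j = h \<cdot> inr C E A \<and> t \<cdot> i = h \<cdot> inl C E A \<longleftrightarrow>
        t \<in> hom C (Cod C (copair C i j)) Z \<and> t \<cdot> copair C i j = h" for t
      using comp_eq_iff[OF q _ h, of t] by (auto simp del: comp_copair)
    ultimately show "\<exists>!t. t \<in> hom C (Cod C (copair C i j)) Z \<and> t \<cdot> copair C i j = h" by simp
  qed (use r in \<open>simp_all add: hom_iff\<close>)
qed

lemma pushout_if_coequalizer:
  assumes q: "is_coequalizer C (\<alpha>' \<cdot> r1) (\<alpha>' \<cdot> r2) q"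
  shows "is_pullback (opp C) (q \<cdot> inr C E A) (q \<cdot> inl C E A) \<alpha> p"
proof -
  note r = homD(1-3)[OF S.r(1)] homD(1-3)[OF S.r(2)]
  have qh: "q \<in> hom C (E \<oplus> A) (Cod C q)"
    using coequalizerD[OF q] r by (simp add: hom_iff)
  note [simp] = homD(1-2)[OF qh]
  show ?thesis
    unfolding is_pullback_opp
  proof (intro conjI allI ballI impI)
    show "(q \<cdot> inr C E A) \<cdot> \<alpha> = (q \<cdot> inl C E A) \<cdot> p"
      using coequalizing_iff[OF qh] coequalizerD(7)[OF q] by simp
    fix Z y x assume y: "y \<in> hom C (Cod C \<alpha>) Z" and x: "x \<in> hom C (Cod C p) Z" and eq: "y \<cdot> \<alpha> = x \<cdot> p"
    have [simp]: "y \<in> Arr C" "x \<in> Arr C" "Dom C y = A" "Dom C x = E" "Cod C y = Z" "Cod C x = Z" "Z \<in> Obj C"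
      using homD[OF y] homD[OF x] by simp_all
    have h: "copair C x y \<in> hom C (E \<oplus> A) Z" by (simp add: hom_iff)
    have "copair C x y \<cdot> (\<alpha>' \<cdot> r1) = copair C x y \<cdot> (\<alpha>' \<cdot> r2)"
      unfolding coequalizing_iff[OF h] using eq by simp
    moreover have "copair C x y \<in> hom C (Cod C (\<alpha>' \<cdot> r1)) Z" using h r by simp
    ultimately have "\<exists>!k. k \<in> hom C (Cod C q) Z \<and> k \<cdot> q = copair C x y"
      using q unfolding is_coequalizer_def by blast
    moreover have "k \<in> hom C (Cod C q) Z \<and> k \<cdot> q = copair C x y \<longleftrightarrow>
        k \<in> hom C (Cod C (q \<cdot> inr C E A)) Z \<and> k \<cdot> (q \<cdot> inr C E A) = y \<and> k \<cdot> (q \<cdot> inl C E A) = x" for k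
      using comp_eq_iff[OF qh _ h, of k] by auto
    ultimately show "\<exists>!k. k \<in> hom C (Cod C (q \<cdot> inr C E A)) Z \<and>
        k \<cdot> (q \<cdot> inr C E A) = y \<and> k \<cdot> (q \<cdot> inl C E A) = x" by simp
  qed simp_all
qed

end

context exact_condition_P
begin

lemma reduction_kernel_pair:
  assumes "p \<in> hom C B E"
  obtains r1 r2 R where "is_pullback C r2 r1 (copair C (Ident C E) p) (copair C (Ident C E) p)" "Dom C r2 = R"
proof -
  have "copair C (Ident C E) p \<in> hom C (E \<oplus> B) E" using homD[OF assms] by (simp add: hom_iff)
  then show ?thesis using pullback_exists[OF fin_complete] that by blast
qed

lemma pushout_exists:
  assumes "p \<in> hom C B E" "\<alpha> \<in> hom C B A" "\<beta> \<in> hom C A B" "\<beta> \<cdot> \<alpha> = Ident C B"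
  obtains j i where "is_pullback (opp C) j i \<alpha> p"
proof -
  obtain r1 r2 R where "is_pullback C r2 r1 (copair C (Ident C E) p) (copair C (Ident C E) p)" "Dom C r2 = R"
    by (rule reduction_kernel_pair[OF assms(1)])
  then interpret pushout_reduction C p r1 r2 \<alpha> \<beta> A B E R
    using assms by unfold_locales
  obtain q where "is_coequalizer C (plus_arr C (Ident C E) \<alpha> \<cdot> r1) (plus_arr C (Ident C E) \<alpha> \<cdot> r2) q"
    by (rule S.quotient_exists)
  then show ?thesis by (rule that[OF pushout_if_coequalizer])
qed

text \<open>After the reduction the coequalizers are \<open>[i, j]\<close> and
  \<open>[i', j']\<close>, and the same \<open>h\<close> lies over \<open>1 + f\<close>. So
  \<open>1 + f\<close> is invertible, and \<open>iso_if_iso_plus\<close> cancels the summand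
  \<open>E\<close>.\<close>

lemma pushout_reflects_iso:
  assumes p: "p \<in> hom C B E"
    and \<alpha>: "\<alpha> \<in> hom C B A" "\<beta> \<in> hom C A B" "\<beta> \<cdot> \<alpha> = Ident C B"
    and \<alpha>': "\<alpha>' \<in> hom C B A'" "\<beta>' \<in> hom C A' B" "\<beta>' \<cdot> \<alpha>' = Ident C B"
    and f: "f \<in> hom C A A'" "f \<cdot> \<alpha> = \<alpha>'" "\<beta>' \<cdot> f = \<beta>"
    and po: "is_pullback (opp C) j i \<alpha> p" and po': "is_pullback (opp C) j' i' \<alpha>' p"
    and h: "h \<in> hom C (Cod C j) (Cod C j')" "iso C h" "h \<cdot> j = j' \<cdot> f" "h \<cdot> i = i'"
  shows "iso C f"
proof -
  obtain r1 r2 R where kp: "is_pullback C r2 r1 (copair C (Ident C E) p) (copair C (Ident C E) p)" "Dom C r2 = R"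
    by (rule reduction_kernel_pair[OF p])
  interpret P: pushout_reduction C p r1 r2 \<alpha> \<beta> A B E R
    using p \<alpha> kp by unfold_locales
  interpret P': pushout_reduction C p r1 r2 \<alpha>' \<beta>' A' B E R
    using p \<alpha>' kp by unfold_locales
  have [simp]: "j \<in> Arr C" "i \<in> Arr C" "Cod C j = Cod C i" "Dom C j = A" "Dom C i = E"
    "j' \<in> Arr C" "i' \<in> Arr C" "Cod C j' = Cod C i'" "Dom C j' = A'" "Dom C i' = E"
    using po po' by (simp_all add: is_pullback_opp)
  note [simp] = homD(1-3)[OF f(1)]
  have hh: "h \<in> Arr C" "Dom C h = Cod C i" "Cod C h = Cod C i'" using h(1) by (simp_all add: hom_iff)
  have "iso C (plus_arr C (Ident C E) f)"
  proof (rule quotient_reflects_iso[OF P.split_mono_kernel_pair P'.split_mono_kernel_pair _ _ _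
        P.coequalizer_if_pushout[OF po] P'.coequalizer_if_pushout[OF po'] _ _ h(2)])
    show "h \<cdot> copair C i j = copair C i' j' \<cdot> plus_arr C (Ident C E) f"
      using h hh by simp
  qed (use f h hh in \<open>simp_all add: hom_iff\<close>)
  then show ?thesis by (rule iso_if_iso_plus[OF f(1) homD(5)[OF p]])
qed

end

section \<open>Isomorphisms of points\<close>

lemma projections_pullback:
  assumes "is_pullback D \<pi>2 \<pi>1 \<alpha> p" "projections D p \<alpha> = (\<pi>1', \<pi>2')"
  shows "is_pullback D \<pi>2' \<pi>1' \<alpha> p"
proof -
  have "case projections D p \<alpha> of (\<pi>1, \<pi>2) \<Rightarrow> is_pullback D \<pi>2 \<pi>1 \<alpha> p"
    unfolding projections_def by (rule someI[of _ "(\<pi>1, \<pi>2)"]) (simp add: assms(1))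
  then show ?thesis by (simp add: assms(2))
qed

context category
begin

lemma iso_if_iso_Pt:
  assumes "iso (Pt C B) ((A, \<alpha>, \<beta>), f, (A', \<alpha>', \<beta>'))"
  shows "iso C f"
  using assms unfolding iso_def by (auto simp: Pt_def hom_iff hom_def)

text \<open>The inverse of an invertible morphism of points is automatically compatible with
  projections and sections.\<close>

lemma iso_Pt_if_iso:
  assumes F: "((A, \<alpha>, \<beta>), f, (A', \<alpha>', \<beta>')) \<in> Arr (Pt C B)" and "iso C f"
  shows "iso (Pt C B) ((A, \<alpha>, \<beta>), f, (A', \<alpha>', \<beta>'))"
proof -
  have pts: "(A, \<alpha>, \<beta>) \<in> points C B" "(A', \<alpha>', \<beta>') \<in> points C B"
    and f: "f \<in> hom C A A'" "\<alpha>' \<cdot> f = \<alpha>" "f \<cdot> \<beta> = \<beta>'"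
    using F by (auto simp: Pt_def)
  have ty: "\<alpha>' \<in> hom C A' B" "\<beta> \<in> hom C B A" using pts by (auto simp: points_def)
  obtain g where g: "g \<in> hom C A' A" "g \<cdot> f = Ident C A" "f \<cdot> g = Ident C A'"
    using assms(2) f(1) by (auto simp: iso_def hom_iff)
  note [simp] = homD[OF f(1)] homD(1-3)[OF g(1)] homD(1-3)[OF ty(1)] homD(1-3)[OF ty(2)]
  have "\<alpha> \<cdot> g = \<alpha>'" unfolding f(2)[symmetric] using g by simp
  moreover have "g \<cdot> \<beta>' = \<beta>" unfolding f(3)[symmetric] using comp_cong1[OF g(2), of \<beta>] by simp
  ultimately have "((A', \<alpha>', \<beta>'), g, (A, \<alpha>, \<beta>)) \<in> Arr (Pt C B)"
    using pts g by (auto simp: Pt_def)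
  then show ?thesis
    unfolding iso_def using F g
    by (intro conjI bexI[of _ "((A', \<alpha>', \<beta>'), g, (A, \<alpha>, \<beta>))"]) (auto simp: Pt_def hom_def)
qed

end

theorem theorem4p12:
  fixes C :: "('o, 'm) cat"
  assumes "exact_category C"
    and "condition_P C"
  shows "coprotomodular C"
proof -
  have "category C" using assms(2) by (simp add: condition_P_def finitely_complete_def)
  then interpret exact_condition_P C
    by (intro exact_condition_P.intro exact_condition_P_axioms.intro assms)
  interpret D: category "opp C" by (rule category_opp[OF category_axioms])
  have pushouts: "has_split_epi_pullbacks (opp C)"
    unfolding has_split_epi_pullbacks_def
  proof (intro allI impI)
    fix p \<alpha>
    assume "p \<in> Arr (opp C) \<and> split_epi (opp C) \<alpha> \<and> Cod (opp C) \<alpha> = Cod (opp C) p"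
    then obtain \<beta> where "p \<in> hom C (Dom C p) (Cod C p)" "\<alpha> \<in> hom C (Dom C p) (Cod C \<alpha>)"
        "\<beta> \<in> hom C (Cod C \<alpha>) (Dom C p)" "\<beta> \<cdot>\<^bsub>C\<^esub> \<alpha> = Ident C (Dom C p)"
      by (auto simp: split_epi_def hom_iff)
    then show "\<exists>\<pi>1 \<pi>2. is_pullback (opp C) \<pi>2 \<pi>1 \<alpha> p"
      by (rule pushout_exists) blast
  qed
  have "reflects_isos (Pt (opp C) B) (Pt (opp C) E) (pullback_functor (opp C) p)"
    if p: "p \<in> hom (opp C) E B" for E B p
    unfolding reflects_isos_def
  proof (intro ballI impI)
    fix F assume F: "F \<in> Arr (Pt (opp C) B)"
      and iso: "iso (Pt (opp C) E) (FArr (pullback_functor (opp C) p) F)"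
    obtain A \<alpha> \<beta> f A' \<alpha>' \<beta>' where F_eq: "F = ((A, \<alpha>, \<beta>), f, (A', \<alpha>', \<beta>'))" by (metis prod.exhaust)
    \<comment> \<open>Read in \<open>C\<close>, \<alpha> is the split monomorphism, \<beta> its
      retraction, and \<open>f\<close> runs backwards, from \<open>A'\<close> to
      \<open>A\<close>.\<close>
    have ty: "\<alpha> \<in> hom C B A" "\<beta> \<in> hom C A B" "\<beta> \<cdot>\<^bsub>C\<^esub> \<alpha> = Ident C B"
        "\<alpha>' \<in> hom C B A'" "\<beta>' \<in> hom C A' B" "\<beta>' \<cdot>\<^bsub>C\<^esub> \<alpha>' = Ident C B"
        "f \<in> hom C A' A" "f \<cdot>\<^bsub>C\<^esub> \<alpha>' = \<alpha>" "\<beta> \<cdot>\<^bsub>C\<^esub> f = \<beta>'" and p': "p \<in> hom C B E"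
      using F p unfolding F_eq by (auto simp: Pt_def points_def)
    obtain i j where pr: "projections (opp C) p \<alpha> = (i, j)" by fastforce
    obtain i' j' where pr': "projections (opp C) p \<alpha>' = (i', j')" by fastforce
    have pb: "is_pullback (opp C) j i \<alpha> p"
      using projections_pullback[of "opp C" _ _ \<alpha> p] pushout_exists[OF p' ty(1-3)] pr by metis
    have pb': "is_pullback (opp C) j' i' \<alpha>' p"
      using projections_pullback[of "opp C" _ _ \<alpha>' p] pushout_exists[OF p' ty(4-6)] pr' by metis
    define h where "h = pb_pair (opp C) (i', j') i (f \<cdot>\<^bsub>opp C\<^esub> j)"
    have "\<exists>!h. h \<in> hom (opp C) (Dom (opp C) i) (Dom (opp C) i') \<and> i' \<cdot>\<^bsub>opp C\<^esub> h = i \<and> j' \<cdot>\<^bsub>opp C\<^esub> h = f \<cdot>\<^bsub>opp C\<^esub> j"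
    proof -
      note D = D.pullbackD[OF pb, simplified] D.pullbackD[OF pb', simplified]
      have "comm_square (opp C) (f \<cdot>\<^bsub>opp C\<^esub> j) i \<alpha>' p"
        using D ty homD[OF ty(4)] homD[OF ty(7)] homD[OF p'] unfolding comm_square_def by (auto simp: hom_iff)
      then have "\<exists>!h. h \<in> hom (opp C) (Dom (opp C) (f \<cdot>\<^bsub>opp C\<^esub> j)) (Dom (opp C) j') \<and>
          j' \<cdot>\<^bsub>opp C\<^esub> h = f \<cdot>\<^bsub>opp C\<^esub> j \<and> i' \<cdot>\<^bsub>opp C\<^esub> h = i"
        using pb' unfolding is_pullback_def by blast
      moreover have "Dom (opp C) (f \<cdot>\<^bsub>opp C\<^esub> j) = Dom (opp C) i" "Dom (opp C) j' = Dom (opp C) i'"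
        using D homD[OF ty(1)] homD[OF ty(7)] by simp_all
      ultimately show ?thesis by (simp only: conj_commute)
    qed
    then have h: "h \<in> hom (opp C) (Dom (opp C) i) (Dom (opp C) i') \<and> i' \<cdot>\<^bsub>opp C\<^esub> h = i \<and> j' \<cdot>\<^bsub>opp C\<^esub> h = f \<cdot>\<^bsub>opp C\<^esub> j"
      unfolding h_def pb_pair_def prod.case by (rule theI')
    \<comment> \<open>The sections \<gamma> and \<gamma>' may stay unspecified: only invertibility
      of the underlying arrow \<open>h\<close> is extracted.\<close>
    obtain \<gamma> \<gamma>' where "FArr (pullback_functor (opp C) p) F =
        ((Dom (opp C) i, i, \<gamma>), h, (Dom (opp C) i', i', \<gamma>'))"
      unfolding F_eq by (simp add: pullback_functor_def pullback_point_def pr pr' h_def)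
    then have "iso (opp C) h"
      using D.iso_if_iso_Pt iso h by (metis homD(1) hom_opp)
    then have "iso C h" by (simp add: iso_opp)
    \<comment> \<open>Primed and unprimed data are interchanged because \<open>f\<close> and
      \<open>h\<close> run backwards in \<open>C\<close>.\<close>
    then have "iso C f"
      using pushout_reflects_iso[OF p' ty(4-6) ty(1-3) ty(7-9) pb' pb, of h] h D.pullbackD(5)[OF pb] D.pullbackD(5)[OF pb']
      by simp
    then show "iso (Pt (opp C) B) F"
      using D.iso_Pt_if_iso F unfolding F_eq by (simp add: iso_opp)
  qed
  then show ?thesis
    unfolding coprotomodular_def protomodular_def
    using pushouts D.category_axioms by blast
qed

end
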